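(* Let $F_n$ be the free group with finite basis $\{x_1,\dots,x_n\}$ and let $\varphi\in\mathrm{Aut}(F_n)$ be a virtually inner automorphism, i.e. $\varphi^m\in\mathrm{Inn}(F_n)$ for some non-zero integer $m$. Then the $\varphi$-twisted conjugacy problem in $F_n$ is solvable: there exists an algorithm which, given an arbitrary pair of words $U,V$ in the alphabet $\{x_1^{\pm1},\dots,x_n^{\pm1}\}$, determines whether there exists $X\in F_n$ such that $\varphi(X)\,U=V\,X$ in $F_n$.
   Context: $\mathrm{Aut}(F_n)$ and $\mathrm{Inn}(F_n)$ denote the groups of all automorphisms and of all inner automorphisms of $F_n$. An automorphism $\varphi$ of $F_n$ is called virtually inner if $\varphi^m\in\mathrm{Inn}(F_n)$ for some non-zero integer $m$. For a fixed $\varphi\in\mathrm{Aut}(F_n)$, the $\varphi$-twisted conjugacy problem in $F_n$ asks for an algorithm which, given an arbitrary pair of words $U,V$ in the generators and their inverses, decides whether the equation $\varphi(X)\,U=V\,X$ has a solution $X\in F_n$; the problem is called solvable if such an algorithm exists. Here $\varphi$ is given by the images of the basis elements $x_1,\dots,x_n$. *)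

theory Defs
  imports "HOL-Algebra.Bij" "HOL-Library.Nat_Bijection"
begin

section \<open>Free groups of finite rank\<close>

text \<open>
  The letter \<open>(i, False)\<close> stands for the basis element \<open>x\<^sub>i\<close> and \<open>(i, True)\<close> for its formal
  inverse; the basis of the free group of rank \<open>n\<close> is indexed by \<open>0, \<dots>, n - 1\<close>.
\<close>

type_synonym letter = "nat \<times> bool"
type_synonym word = "letter list"

definition inv_letter :: "letter \<Rightarrow> letter" where
  "inv_letter a = (fst a, \<not> snd a)"

definition words :: "nat \<Rightarrow> word set" where
  "words n = lists ({..<n} \<times> UNIV)"

definition reduced :: "word \<Rightarrow> bool" where
  "reduced w \<longleftrightarrow> successively (\<lambda>a b. b \<noteq> inv_letter a) w"

fun cons_letter :: "letter \<Rightarrow> word \<Rightarrow> word" where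
  "cons_letter a [] = [a]"
| "cons_letter a (b # w) = (if b = inv_letter a then w else a # b # w)"

definition reduce :: "word \<Rightarrow> word" where
  "reduce w = foldr cons_letter w []"

text \<open>
  Elements of the free group are the reduced words. An arbitrary word \<open>U \<in> words n\<close> represents
  the element \<open>reduce U\<close>.
\<close>

definition free_group :: "nat \<Rightarrow> word monoid" where
  "free_group n = \<lparr>carrier = {w \<in> words n. reduced w}, mult = (\<lambda>u v. reduce (u @ v)), one = []\<rparr>"

lemma inv_letter_simps [simp]:
  "inv_letter (inv_letter a) = a" "inv_letter a \<noteq> a" "a \<noteq> inv_letter a"
  "inv_letter a = inv_letter b \<longleftrightarrow> a = b"
  by (auto simp: inv_letter_def prod_eq_iff)

lemma reduced_simps [simp]:
  "reduced []" "reduced [a]"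
  "reduced (a # b # w) \<longleftrightarrow> b \<noteq> inv_letter a \<and> reduced (b # w)"
  by (auto simp: reduced_def)

lemma reduced_ConsD: "reduced (a # w) \<Longrightarrow> reduced w"
  by (cases w) auto

lemma reduced_cons_letter: "reduced w \<Longrightarrow> reduced (cons_letter a w)"
  by (cases w) (auto dest: reduced_ConsD)

lemma cons_letter_Cons: "reduced (a # w) \<Longrightarrow> cons_letter a w = a # w"
  by (cases w) auto

lemma cons_letter_inverse: "reduced w \<Longrightarrow> cons_letter a (cons_letter (inv_letter a) w) = w"
  by (cases w) (auto simp: cons_letter_Cons)

lemma reduce_simps [simp]: "reduce [] = []" "reduce (a # w) = cons_letter a (reduce w)"
  by (simp_all add: reduce_def)

lemma reduced_reduce: "reduced (reduce w)"
  by (induction w) (auto intro: reduced_cons_letter)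

lemma reduce_reduced: "reduced w \<Longrightarrow> reduce w = w"
proof (induction w)
  case (Cons a w)
  then show ?case
    using reduced_ConsD[of a w] cons_letter_Cons[of a w] by simp
qed simp

lemma reduce_cancel: "reduce (u @ a # inv_letter a # v) = reduce (u @ v)"
  by (induction u) (auto simp: cons_letter_inverse reduced_reduce)

lemma reduce_append_right: "reduce (u @ reduce v) = reduce (u @ v)"
  by (induction u) (auto simp: reduce_reduced reduced_reduce)

lemma reduce_cons_letter_append:
  "reduce (cons_letter a w @ v) = cons_letter a (reduce (w @ v))"
  by (cases w) (simp_all add: cons_letter_inverse reduced_reduce)

lemma reduce_append_left: "reduce (reduce u @ v) = reduce (u @ v)"
  by (induction u) (auto simp: reduce_cons_letter_append)

lemma reduce_append: "reduce (u @ v) = reduce u \<otimes>\<^bsub>free_group n\<^esub> reduce v"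
  by (simp add: free_group_def reduce_append_left reduce_append_right)

lemma cons_letter_in_words: "a \<in> {..<n} \<times> UNIV \<Longrightarrow> w \<in> words n \<Longrightarrow> cons_letter a w \<in> words n"
  by (cases w) (auto simp: words_def)

lemma reduce_in_words: "w \<in> words n \<Longrightarrow> reduce w \<in> words n"
proof (induction w)
  case (Cons a w)
  then show ?case
    using cons_letter_in_words[of a n "reduce w"] by (simp add: words_def)
qed simp

lemma reduce_in_carrier: "w \<in> words n \<Longrightarrow> reduce w \<in> carrier (free_group n)"
  by (simp add: free_group_def reduce_in_words reduced_reduce)

lemma reduce_inverse_word: "reduce (rev (map inv_letter w) @ w) = []"
proof (induction w)
  case (Cons a w)
  then show ?case
    using reduce_cancel[of "rev (map inv_letter w)" "inv_letter a" w] by simp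
qed simp

lemma group_free_group: "group (free_group n)"
proof (rule groupI)
  fix x y z
  assume "x \<in> carrier (free_group n)" "y \<in> carrier (free_group n)"
  then show "x \<otimes>\<^bsub>free_group n\<^esub> y \<in> carrier (free_group n)"
    using reduce_in_words[of "x @ y" n]
    by (auto simp: free_group_def reduced_reduce words_def)
  show "x \<otimes>\<^bsub>free_group n\<^esub> y \<otimes>\<^bsub>free_group n\<^esub> z
      = x \<otimes>\<^bsub>free_group n\<^esub> (y \<otimes>\<^bsub>free_group n\<^esub> z)"
    by (simp add: free_group_def reduce_append_left reduce_append_right)
next
  fix x
  assume x: "x \<in> carrier (free_group n)"
  show "\<one>\<^bsub>free_group n\<^esub> \<otimes>\<^bsub>free_group n\<^esub> x = x"
    using x by (simp add: free_group_def reduce_reduced)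
  have "rev (map inv_letter x) \<in> words n"
    using x by (fastforce simp: free_group_def words_def inv_letter_def)
  then have "reduce (rev (map inv_letter x)) \<in> carrier (free_group n)"
    by (rule reduce_in_carrier)
  moreover have "reduce (rev (map inv_letter x)) \<otimes>\<^bsub>free_group n\<^esub> x = \<one>\<^bsub>free_group n\<^esub>"
    using reduce_inverse_word[of x] by (simp add: free_group_def reduce_append_left)
  ultimately show "\<exists>y\<in>carrier (free_group n). y \<otimes>\<^bsub>free_group n\<^esub> x = \<one>\<^bsub>free_group n\<^esub>"
    by blast
qed (auto simp: free_group_def words_def)

fun word_value :: "('a, 'b) monoid_scheme \<Rightarrow> (nat \<Rightarrow> 'a) \<Rightarrow> word \<Rightarrow> 'a" where
  "word_value G f [] = \<one>\<^bsub>G\<^esub>"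
| "word_value G f (a # w) = (if snd a then inv\<^bsub>G\<^esub> f (fst a) else f (fst a)) \<otimes>\<^bsub>G\<^esub> word_value G f w"

text \<open>The universal property with respect to the basis \<open>[(0, False)], \<dots>, [(n - 1, False)]\<close>.\<close>

theorem free_group_universal:
  assumes "group G" and f: "\<And>i. i < n \<Longrightarrow> f i \<in> carrier G"
  shows "\<exists>!h. h \<in> hom (free_group n) G \<inter> extensional (carrier (free_group n))
           \<and> (\<forall>i<n. h [(i, False)] = f i)"
proof -
  interpret G: group G by fact
  let ?F = "free_group n"
  let ?e = "word_value G f"
  have closed: "?e w \<in> carrier G" if "w \<in> words n" for w
    using that by (induction w) (auto simp: words_def f)
  have app: "?e (u @ v) = ?e u \<otimes>\<^bsub>G\<^esub> ?e v" if "u \<in> words n" "v \<in> words n" for u v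
    using that
  proof (induction u)
    case (Cons a u)
    then show ?case
      using closed[of u] closed[of v] by (auto simp: words_def f G.m_assoc)
  qed (simp add: closed)
  have cons: "?e (cons_letter a w) = ?e (a # w)" if "a # w \<in> words n" for a w
  proof (cases w)
    case (Cons b v)
    show ?thesis
    proof (cases "b = inv_letter a")
      case True
      have "v \<in> words n" "fst a < n"
        using that Cons by (auto simp: words_def)
      then show ?thesis
        using Cons True closed[of v] f[of "fst a"]
        by (auto simp: inv_letter_def G.m_assoc[symmetric])
    qed (simp add: Cons)
  qed simp
  have red: "?e (reduce w) = ?e w" if "w \<in> words n" for w
    using that
  proof (induction w)
    case (Cons a w)
    then have "a # reduce w \<in> words n" "w \<in> words n"
      using reduce_in_words[of w n] by (auto simp: words_def)
    with Cons show ?case by (simp add: cons)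
  qed simp
  let ?h = "restrict ?e (carrier ?F)"
  have carr: "w \<in> words n" if "w \<in> carrier ?F" for w
    using that by (simp add: free_group_def)
  have mult: "u \<otimes>\<^bsub>?F\<^esub> v = reduce (u @ v)" for u v
    by (simp add: free_group_def)
  have app_words: "u @ v \<in> words n" if "u \<in> words n" "v \<in> words n" for u v
    using that by (auto simp: words_def)
  have hom: "?h \<in> hom ?F G"
  proof (rule homI)
    fix u v assume "u \<in> carrier ?F" "v \<in> carrier ?F"
    then show "?h (u \<otimes>\<^bsub>?F\<^esub> v) = ?h u \<otimes>\<^bsub>G\<^esub> ?h v"
      using carr by (simp add: mult reduce_in_carrier app_words red app)
  qed (simp add: closed carr)
  have gen: "[(i, b)] \<in> carrier ?F" if "i < n" for i b
    using that by (auto simp: free_group_def words_def)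
  show ?thesis
  proof (rule ex1I[of _ ?h])
    show "?h \<in> hom ?F G \<inter> extensional (carrier ?F) \<and> (\<forall>i<n. ?h [(i, False)] = f i)"
      using hom gen f by auto
  next
    fix g
    assume g: "g \<in> hom ?F G \<inter> extensional (carrier ?F) \<and> (\<forall>i<n. g [(i, False)] = f i)"
    interpret F: group ?F by (rule group_free_group)
    interpret g: group_hom ?F G g
      using g by (simp add: group_hom_def group_hom_axioms_def G.is_group F.is_group)
    have neg: "g [(i, True)] = inv\<^bsub>G\<^esub> f i" if "i < n" for i
    proof -
      have "[(i, True)] \<otimes>\<^bsub>?F\<^esub> [(i, False)] = \<one>\<^bsub>?F\<^esub>"
        by (simp add: free_group_def inv_letter_def)
      then have "[(i, True)] = inv\<^bsub>?F\<^esub> [(i, False)]"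
        using gen[OF that] F.inv_equality by metis
      then show ?thesis
        using g that gen[OF that] by simp
    qed
    have "g w = ?e w" if "w \<in> words n" "reduced w" for w
      using that
    proof (induction w)
      case Nil
      have "g \<one>\<^bsub>?F\<^esub> = \<one>\<^bsub>G\<^esub>" by simp
      then show ?case by (simp add: free_group_def)
    next
      case (Cons a w)
      obtain i b where a: "a = (i, b)" by fastforce
      have w: "w \<in> carrier ?F" and i: "i < n" and IH: "g w = ?e w"
        using Cons reduced_ConsD[of a w] by (auto simp: free_group_def words_def a)
      have "a # w = [a] \<otimes>\<^bsub>?F\<^esub> w"
        using Cons.prems reduce_reduced[of "a # w"] by (simp add: mult)
      then have "g (a # w) = g [a] \<otimes>\<^bsub>G\<^esub> g w"
        using gen[OF i] w a by simp
      then show ?case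
        using g neg[OF i] i IH by (cases b) (auto simp: a)
    qed
    then have "g w = ?h w" if "w \<in> carrier ?F" for w
      using that by (simp add: free_group_def)
    moreover have "?h \<in> extensional (carrier ?F)" by simp
    ultimately show "g = ?h"
      using g by (meson IntE extensionalityI)
  qed
qed


section \<open>Virtually inner automorphisms\<close>

definition Inn :: "('a, 'b) monoid_scheme \<Rightarrow> ('a \<Rightarrow> 'a) set" where
  "Inn G = (\<lambda>g. \<lambda>x\<in>carrier G. g \<otimes>\<^bsub>G\<^esub> x \<otimes>\<^bsub>G\<^esub> inv\<^bsub>G\<^esub> g) ` carrier G"

definition virtually_inner :: "('a, 'b) monoid_scheme \<Rightarrow> ('a \<Rightarrow> 'a) \<Rightarrow> bool" where
  "virtually_inner G \<phi> \<longleftrightarrow> (\<exists>m::int. m \<noteq> 0 \<and> \<phi> [^]\<^bsub>AutoGroup G\<^esub> m \<in> Inn G)"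


section \<open>Algorithms\<close>

text \<open>
  Algorithms are programs for partial recursive functions on the natural numbers, with the usual
  big-step semantics: \<open>eval p xs y\<close> states that \<open>p\<close> halts on input \<open>xs\<close> with output \<open>y\<close>.
\<close>

datatype recf =
    Zero
  | Succ
  | Proj nat
  | Comp recf "recf list"
  | PrimRec recf recf
  | Mu recf

inductive eval :: "recf \<Rightarrow> nat list \<Rightarrow> nat \<Rightarrow> bool" where
  eval_Zero: "eval Zero xs 0"
| eval_Succ: "eval Succ [x] (Suc x)"
| eval_Proj: "i < length xs \<Longrightarrow> eval (Proj i) xs (xs ! i)"
| eval_Comp: "list_all2 (\<lambda>g y. eval g xs y) gs ys \<Longrightarrow> eval f ys z \<Longrightarrow> eval (Comp f gs) xs z"
| eval_PrimRec_0: "eval f xs y \<Longrightarrow> eval (PrimRec f g) (0 # xs) y"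
| eval_PrimRec_Suc: "eval (PrimRec f g) (k # xs) y \<Longrightarrow> eval g (y # k # xs) z
    \<Longrightarrow> eval (PrimRec f g) (Suc k # xs) z"
| eval_Mu: "eval f (k # xs) 0 \<Longrightarrow> (\<forall>j<k. \<exists>y. eval f (j # xs) (Suc y)) \<Longrightarrow> eval (Mu f) xs k"
monos list_all2_mono

inductive_cases eval_ZeroE: "eval Zero xs y"
inductive_cases eval_SuccE: "eval Succ xs y"
inductive_cases eval_ProjE: "eval (Proj i) xs y"
inductive_cases eval_CompE: "eval (Comp f gs) xs y"
inductive_cases eval_PrimRec_0E: "eval (PrimRec f g) (0 # xs) y"
inductive_cases eval_PrimRec_SucE: "eval (PrimRec f g) (Suc k # xs) y"
inductive_cases eval_MuE: "eval (Mu f) xs y"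

theorem eval_deterministic: "eval p xs y \<Longrightarrow> eval p xs z \<Longrightarrow> y = z"
proof (induction arbitrary: z rule: eval.induct)
  case (eval_Comp xs gs ys f y)
  from eval_Comp.prems obtain ys' where ys': "list_all2 (\<lambda>g y. eval g xs y) gs ys'" "eval f ys' z"
    by (auto elim: eval_CompE)
  have "ys = ys'"
    using eval_Comp.IH(1) ys'(1) by (auto simp: list_all2_conv_all_nth intro!: nth_equalityI)
  then show ?case using eval_Comp.IH(2) ys'(2) by simp
next
  case (eval_PrimRec_Suc f g k xs y z')
  from eval_PrimRec_Suc.prems obtain y' where "eval (PrimRec f g) (k # xs) y'" "eval g (y' # k # xs) z"
    by (auto elim: eval_PrimRec_SucE)
  then show ?case using eval_PrimRec_Suc.IH by blast
next
  case (eval_Mu f k xs)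
  from eval_Mu.prems have z: "eval f (z # xs) 0" "\<And>j. j < z \<Longrightarrow> \<exists>y. eval f (j # xs) (Suc y)"
    by (auto elim: eval_MuE)
  have "\<not> k < z" using z(2)[of k] eval_Mu.IH(1) by (metis nat.distinct(1))
  moreover have "\<not> z < k" using z(1) eval_Mu.IH(2) by (metis nat.distinct(1))
  ultimately show ?case by simp
next
  case (eval_PrimRec_0 f xs y g)
  then show ?case by (blast elim: eval_PrimRec_0E)
qed (blast elim: eval_ZeroE eval_SuccE eval_ProjE)+

definition encode_word :: "word \<Rightarrow> nat" where
  "encode_word w = list_encode (map (\<lambda>(i, b). 2 * i + of_bool b) w)"

lemma inj_encode_word: "inj encode_word"
proof -
  have "inj (\<lambda>(i, b). 2 * i + of_bool b :: nat)"
  proof (rule injI, clarify)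
    fix i j :: nat and a b :: bool
    assume "2 * i + of_bool a = 2 * j + of_bool b"
    then show "i = j \<and> a = b" by (cases a; cases b; simp; presburger)
  qed
  then show ?thesis
    unfolding encode_word_def by (intro injI) (simp only: list_encode_eq inj_map_eq_map)
qed

definition decidable_on_words :: "nat \<Rightarrow> (word \<Rightarrow> word \<Rightarrow> bool) \<Rightarrow> bool" where
  "decidable_on_words n R \<longleftrightarrow>
     (\<exists>p. \<forall>U\<in>words n. \<forall>V\<in>words n. eval p [encode_word U, encode_word V] (of_bool (R U V)))"

definition twisted_conjugacy_problem_solvable :: "nat \<Rightarrow> (word \<Rightarrow> word) \<Rightarrow> bool" where
  "twisted_conjugacy_problem_solvable n \<phi> \<longleftrightarrow>
     decidable_on_words n (\<lambda>U V. \<exists>X\<in>carrier (free_group n).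
       \<phi> X \<otimes>\<^bsub>free_group n\<^esub> reduce U = reduce V \<otimes>\<^bsub>free_group n\<^esub> X)"

end

theory Submission
  imports Defs
begin

text \<open>
  Let \<open>\<phi>\<^sup>m\<close> be conjugation by \<open>g\<close>, where \<open>m > 0\<close> and without loss of generality \<open>\<phi>(g) = g\<close>, and put
  \<open>N(U) = \<phi>\<^sup>m\<^sup>-\<^sup>1(U) \<dots> \<phi>(U) U\<close>. Iterating \<open>\<phi>(X) U = V X\<close> shows that \<open>X\<close> conjugates
  \<open>u = g\<^sup>-\<^sup>1 N(U)\<close> to \<open>v = g\<^sup>-\<^sup>1 N(V)\<close>. If \<open>u \<noteq> 1\<close>, then conversely every such \<open>X\<close> solves the twisted
  equation, because centralizers are cyclic, and there is a conjugator of length at most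
  \<open>|u| + |v|\<close>. If \<open>u = v = 1\<close>, then the map \<open>Y \<mapsto> U\<^sup>-\<^sup>1 \<phi>(Y)\<close> of the Cayley tree is a quasi-isometry of
  finite order up to a bounded error, so it almost fixes the centre of an orbit; hence \<open>U\<close> is
  twisted conjugate, by an element of linearly bounded length, to one of finitely many words. In both
  cases the length of a shortest solution \<open>X\<close> is bounded linearly in \<open>|U| + |V|\<close>, and a
  bounded search decides solvability.
\<close>

text \<open>The case of trivial obstructions shapes the proof: every element conjugates 1 to 1, so
  neither conjugacy nor centralizers say anything about \<open>X\<close>, and geometry has to take
  over. The obstacle there is that an automorphism distorts word length by a multiplicative factor,
  so the image of the centre of an orbit could lie far from every centre. Summing the lengths of
  \<open>m\<close> consecutive iterates repairs this: the resulting weight changes under \<phi> by a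
  bounded amount only. The price is that the weight need not be a tree metric; bounded cancellation,
  proved for each iterate, gives back additivity along geodesics up to a constant, which suffices
  for centres to be unique up to a bounded error.

  Nothing here has to be uniform in \<phi>. The linear factor, a maximum over finitely many chosen
  solutions, and the images of the letters may be built into the program as constants, so it is
  enough that they exist.\<close>

lemma reduced_append:
  "reduced (x @ y) \<longleftrightarrow>
     reduced x \<and> reduced y \<and> (x = [] \<or> y = [] \<or> hd y \<noteq> inv_letter (last x))"
  by (auto simp: reduced_def successively_append_iff)

lemma length_reduce_le: "length (reduce w) \<le> length w"
proof (induction w)
  case (Cons a w)
  then show ?case by (cases "reduce w") auto
qed simp

lemma length_reduce_append_less:
  assumes "x \<noteq> []" "y \<noteq> []" "hd y = inv_letter (last x)"
  shows "length (reduce (x @ y)) < length x + length y"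
proof -
  have "x @ y = butlast x @ last x # inv_letter (last x) # tl y"
    using assms by (cases x rule: rev_cases; cases y) auto
  then have "length (reduce (x @ y)) \<le> length (butlast x @ tl y)"
    using length_reduce_le by (simp only: reduce_cancel)
  then show ?thesis using assms by (cases x; cases y) auto
qed

section \<open>The metric geometry of free groups\<close>

locale finite_rank_free_group =
  fixes n :: nat and F (structure)
  assumes F_def: "F = free_group n"

sublocale finite_rank_free_group \<subseteq> group F
  unfolding F_def by (rule group_free_group)

context finite_rank_free_group
begin

lemma carrier_iff: "x \<in> carrier F \<longleftrightarrow> x \<in> words n \<and> reduced x"
  by (auto simp: F_def free_group_def)

lemma mult_eq: "x \<otimes> y = reduce (x @ y)"
  by (simp add: F_def free_group_def)

lemma one_eq: "\<one> = []"
  by (simp add: F_def free_group_def)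

lemma carrier_append:
  "x @ y \<in> carrier F \<longleftrightarrow>
     x \<in> carrier F \<and> y \<in> carrier F \<and> (x = [] \<or> y = [] \<or> hd y \<noteq> inv_letter (last x))"
  by (auto simp: carrier_iff reduced_append words_def)

lemma mult_no_cancel: "x @ y \<in> carrier F \<Longrightarrow> x \<otimes> y = x @ y"
  by (simp add: mult_eq carrier_iff reduce_reduced)

lemma length_mult_le: "length (x \<otimes> y) \<le> length x + length y"
  using length_reduce_le[of "x @ y"] by (simp add: mult_eq)

text \<open>Absence of cancellation is written as membership of the concatenation in the carrier.
  Read as an equation of lengths, it becomes a property of group elements that survives rewriting
  and inversion.\<close>

lemma length_mult_eq_iff:
  assumes "x \<in> carrier F" "y \<in> carrier F"
  shows "length (x \<otimes> y) = length x + length y \<longleftrightarrow> x @ y \<in> carrier F"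
  using assms length_reduce_append_less[of x y] mult_no_cancel[of x y]
  by (auto simp: carrier_append mult_eq)

lemma inv_eq:
  assumes "x \<in> carrier F"
  shows "inv x = rev (map inv_letter x)"
proof (rule inv_equality)
  show "rev (map inv_letter x) \<otimes> x = \<one>"
    by (simp add: mult_eq one_eq reduce_inverse_word)
  have "rev (map inv_letter x) \<in> words n"
    using assms by (fastforce simp: carrier_iff words_def inv_letter_def)
  moreover have "reduced (rev (map inv_letter x))"
    using assms unfolding carrier_iff reduced_def
    by (auto simp: successively_map elim!: successively_mono)
  ultimately show "rev (map inv_letter x) \<in> carrier F"
    by (simp add: carrier_iff)
qed fact

lemma length_inv [simp]: "x \<in> carrier F \<Longrightarrow> length (inv x) = length x"
  by (simp add: inv_eq)

text \<open>This is where the Cayley graph acts as a tree: the geodesic from \<open>x\<close> to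
  \<open>y\<close> runs through the identity unless both lie in the branch of the same first
  letter.\<close>

lemma inv_append_carrier_iff:
  assumes "x \<in> carrier F" "y \<in> carrier F"
  shows "inv x @ y \<in> carrier F \<longleftrightarrow> x = [] \<or> y = [] \<or> hd x \<noteq> hd y"
proof -
  have "inv x \<in> carrier F" using assms by simp
  moreover have "x \<noteq> [] \<Longrightarrow> last (inv x) = inv_letter (hd x)"
    using assms by (simp add: inv_eq last_rev hd_map)
  ultimately show ?thesis
    using assms by (auto simp: carrier_append inv_eq)
qed

lemma append_inv_carrier_iff:
  assumes "x \<in> carrier F" "y \<in> carrier F"
  shows "x @ inv y \<in> carrier F \<longleftrightarrow> x = [] \<or> y = [] \<or> last x \<noteq> last y"
proof -
  have "inv y \<in> carrier F" using assms by simp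
  moreover have "y \<noteq> [] \<Longrightarrow> hd (inv y) = inv_letter (last y)"
    using assms by (simp add: inv_eq hd_rev last_map)
  ultimately show ?thesis
    using assms by (auto simp: carrier_append inv_eq)
qed

lemma inv_mult_cancel [simp]:
  "x \<in> carrier F \<Longrightarrow> y \<in> carrier F \<Longrightarrow> inv x \<otimes> (x \<otimes> y) = y"
  "x \<in> carrier F \<Longrightarrow> y \<in> carrier F \<Longrightarrow> x \<otimes> (inv x \<otimes> y) = y"
  by (simp_all flip: m_assoc)

lemma carrier_take: "x \<in> carrier F \<Longrightarrow> take i x \<in> carrier F"
  using carrier_append[of "take i x" "drop i x"] by simp

lemma carrier_drop: "x \<in> carrier F \<Longrightarrow> drop i x \<in> carrier F"
  using carrier_append[of "take i x" "drop i x"] by simp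

lemma take_mult_drop: "x \<in> carrier F \<Longrightarrow> take i x \<otimes> drop i x = x"
  using mult_no_cancel[of "take i x" "drop i x"] by simp

lemma take_Suc_mult:
  assumes "x \<in> carrier F" "i < length x"
  shows "take (Suc i) x = take i x \<otimes> [x ! i]" "[x ! i] \<in> carrier F"
proof -
  have "take i x @ [x ! i] \<in> carrier F"
    using assms carrier_take[of x "Suc i"] by (simp add: take_Suc_conv_app_nth)
  then show "take (Suc i) x = take i x \<otimes> [x ! i]" "[x ! i] \<in> carrier F"
    using assms mult_no_cancel[of "take i x" "[x ! i]"]
    by (simp_all add: take_Suc_conv_app_nth carrier_append)
qed

subsection \<open>Cyclically reduced elements\<close>

definition cyc_reduced :: "word \<Rightarrow> bool" where
  "cyc_reduced c \<longleftrightarrow> c @ c \<in> carrier F"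

lemma cyc_reduced_carrier: "cyc_reduced c \<Longrightarrow> c \<in> carrier F"
  by (simp add: cyc_reduced_def carrier_append)

text \<open>In terms of length the condition concerns only the square of \<open>c\<close>, and the
  square of \<open>inv c\<close> is its inverse.\<close>

lemma cyc_reduced_inv: "cyc_reduced c \<Longrightarrow> cyc_reduced (inv c)"
proof -
  assume c: "cyc_reduced c"
  then have "c \<in> carrier F" by (rule cyc_reduced_carrier)
  with c show ?thesis
    using length_mult_eq_iff[of c c] length_mult_eq_iff[of "inv c" "inv c"]
    by (metis cyc_reduced_def inv_closed inv_mult_group length_inv m_closed)
qed

text \<open>While the outer letters are mutually inverse, strip both. The equation holds between
  words, so the length of \<open>x\<close> is that of \<open>c\<close> plus twice that of
  \<open>y\<close>, which later pays for the conjugating parts in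
  \<open>short_conjugator\<close>.\<close>

lemma cyc_reduced_decomposition:
  assumes "x \<in> carrier F"
  obtains y c where "cyc_reduced c" "y \<in> carrier F" "x = y @ c @ inv y"
  using assms
proof (induction "length x" arbitrary: x thesis rule: less_induct)
  case less
  show ?case
  proof (cases "cyc_reduced x")
    case True
    then show ?thesis
      using less.prems(1)[of x "[]"] one_closed inv_one by (simp add: one_eq)
  next
    case False
    then have x: "x \<noteq> []" "hd x = inv_letter (last x)"
      using less.prems(2) by (auto simp: cyc_reduced_def carrier_append)
    then have "tl x \<noteq> []"
      by (metis inv_letter_simps(3) last_ConsL list.collapse)
    then obtain s z t where z: "x = s # z @ [t]"
      using x(1) by (metis append_butlast_last_id list.collapse)
    then have s: "s = inv_letter t" using x by simp
    have "[s] @ z @ [t] \<in> carrier F" using less.prems(2) z by simp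
    then have zc: "z \<in> carrier F" by (simp only: carrier_append)
    have "length z < length x" using z by simp
    then obtain y c where yc: "cyc_reduced c" "y \<in> carrier F" "z = y @ c @ inv y"
      using less.hyps[OF _ _ zc] by blast
    have "(s # y) @ c @ inv y @ [t] \<in> carrier F"
      using less.prems(2) z unfolding yc(3) by simp
    then have ycar: "s # y \<in> carrier F" by (simp only: carrier_append)
    have "inv (s # y) = inv y @ [t]"
      using ycar yc(2) s by (simp add: inv_eq)
    then have "x = (s # y) @ c @ inv (s # y)"
      using z yc(3) by simp
    then show ?thesis
      using less.prems(1) yc(1) ycar by blast
  qed
qed

lemma conj_eq_append:
  assumes "y @ c @ inv y \<in> carrier F"
  shows "y \<otimes> c \<otimes> inv y = y @ c @ inv y"
proof -
  have "y @ c \<in> carrier F" using assms carrier_append[of "y @ c" "inv y"] by simp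
  then show ?thesis
    using mult_no_cancel[of y c] mult_no_cancel[of "y @ c" "inv y"] assms by simp
qed

lemma conj_pow:
  fixes k :: nat
  assumes "y \<in> carrier F" "c \<in> carrier F"
  shows "(y \<otimes> c \<otimes> inv y) [^] k = y \<otimes> c [^] k \<otimes> inv y"
  using assms by (induction k) (simp_all add: m_assoc)

lemma cyc_reduced_pow:
  fixes k :: nat
  assumes "cyc_reduced c"
  shows "c [^] k = concat (replicate k c)" "concat (replicate k c) \<in> carrier F"
    "k > 0 \<Longrightarrow> c \<noteq> [] \<Longrightarrow> hd (c [^] k) = hd c \<and> last (c [^] k) = last c \<and> c [^] k \<noteq> []"
proof -
  have c: "c \<in> carrier F" by (simp add: assms cyc_reduced_carrier)
  have *: "hd (concat (replicate k c)) = hd c \<and> last (concat (replicate k c)) = last c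
      \<and> concat (replicate k c) \<noteq> []" if "k > 0" "c \<noteq> []" for k
    using that by (induction k) (auto simp: hd_append last_append)
  have carr: "concat (replicate k c) \<in> carrier F" for k
  proof (induction k)
    case (Suc k)
    then show ?case
      using *[of k] c assms by (cases "k = 0 \<or> c = []") (auto simp: carrier_append cyc_reduced_def)
  qed (use one_closed in \<open>simp add: one_eq\<close>)
  have pow: "c [^] k = concat (replicate k c)" for k
  proof (induction k)
    case (Suc k)
    have "c [^] Suc k = c \<otimes> c [^] k"
      using c by (metis nat_pow_Suc2)
    then show ?case
      using Suc carr[of "Suc k"] mult_no_cancel by simp
  qed (simp add: one_eq)
  show "c [^] k = concat (replicate k c)" "concat (replicate k c) \<in> carrier F"
    by (fact pow carr)+
  show "hd (c [^] k) = hd c \<and> last (c [^] k) = last c \<and> c [^] k \<noteq> []" if "k > 0" "c \<noteq> []"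
    using *[OF that] by (simp add: pow)
qed

lemma decomposition_pow:
  fixes k :: nat
  assumes "cyc_reduced c" "y \<in> carrier F" "y @ c @ inv y \<in> carrier F" "c \<noteq> []" "k > 0"
  shows "(y @ c @ inv y) [^] k = y @ c [^] k @ inv y" "y @ c [^] k @ inv y \<in> carrier F"
proof -
  have c: "c \<in> carrier F" by (simp add: assms cyc_reduced_carrier)
  show carr: "y @ c [^] k @ inv y \<in> carrier F"
    using assms(3) cyc_reduced_pow[OF assms(1), of k] assms(4,5) c
    by (auto simp: carrier_append hd_append)
  show "(y @ c @ inv y) [^] k = y @ c [^] k @ inv y"
    using conj_pow[OF assms(2) c] conj_eq_append[OF assms(3)] conj_eq_append[OF carr] by simp
qed

text \<open>Torsion-freeness: a nonempty cyclically reduced core stays nonempty in every positive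
  power.\<close>

lemma pow_eq_one_imp:
  assumes "x \<in> carrier F" "x [^] (k::nat) = \<one>" "k > 0"
  shows "x = \<one>"
proof -
  obtain y c where yc: "cyc_reduced c" "y \<in> carrier F" "x = y @ c @ inv y"
    using cyc_reduced_decomposition[OF assms(1)] .
  have c: "c \<in> carrier F" by (simp add: yc cyc_reduced_carrier)
  have "c = []"
    using decomposition_pow(1)[OF yc(1,2) _ _ assms(3)] assms(1,2) cyc_reduced_pow(3)[OF yc(1) assms(3)]
    unfolding yc(3) by (auto simp: one_eq)
  then show ?thesis
    using conj_eq_append[of y c] assms(1) yc c by (simp add: one_eq[symmetric])
qed

text \<open>Conjugate so that \<open>a\<close> becomes a cyclically reduced \<open>c\<close>. The
  outer letters of the power of \<open>c\<close> do not cancel, which leaves no room for a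
  conjugating part \<open>z\<close> in the other root. Both powers are then plain repetitions of
  equal length, and their first blocks agree.\<close>

lemma pow_inject:
  assumes a: "a \<in> carrier F" and b: "b \<in> carrier F" and eq: "a [^] (k::nat) = b [^] k" and k: "k > 0"
  shows "a = b"
proof (cases "a = \<one>")
  case True
  then show ?thesis using pow_eq_one_imp[OF b _ k] eq by simp
next
  case a1: False
  obtain y c where yc: "cyc_reduced c" "y \<in> carrier F" "a = y @ c @ inv y"
    using cyc_reduced_decomposition[OF a] .
  have c: "c \<in> carrier F" by (simp add: yc cyc_reduced_carrier)
  have a_eq: "a = y \<otimes> c \<otimes> inv y" using conj_eq_append a yc by simp
  define b' where "b' = inv y \<otimes> b \<otimes> y"
  have b': "b' \<in> carrier F" and b_eq: "b = y \<otimes> b' \<otimes> inv y"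
    using b yc(2) by (simp_all add: b'_def m_assoc)
  have eq': "c [^] k = b' [^] k"
    using eq yc(2) c b' unfolding a_eq b_eq by (simp add: conj_pow)
  have c1: "c \<noteq> []" using a1 a_eq yc by (auto simp: one_eq[symmetric])
  obtain z d where zd: "cyc_reduced d" "z \<in> carrier F" "b' = z @ d @ inv z"
    using cyc_reduced_decomposition[OF b'] .
  have d: "d \<in> carrier F" by (simp add: zd cyc_reduced_carrier)
  have d1: "d \<noteq> []"
  proof
    assume "d = []"
    then have "b' = \<one>" using conj_eq_append[of z d] b' zd by (simp add: one_eq[symmetric])
    then have "c [^] k = \<one>" using eq' by simp
    then show False using cyc_reduced_pow(3)[OF yc(1) k c1] by (simp add: one_eq)
  qed
  have ck: "c [^] k = z @ d [^] k @ inv z"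
    using decomposition_pow(1)[OF zd(1,2) _ d1 k] b' zd(3) eq' by simp
  have "z = []"
  proof (rule ccontr)
    assume z: "z \<noteq> []"
    then have "hd (c [^] k) = inv_letter (last (c [^] k))"
      using zd(2) ck by (simp add: inv_eq last_rev hd_map)
    then show False
      using cyc_reduced_pow(3)[OF yc(1) k c1] yc(1) c1 by (simp add: cyc_reduced_def carrier_append)
  qed
  then have b'd: "b' = d" "c [^] k = d [^] k"
    using zd(3) ck inv_one by (simp_all add: one_eq)
  have eq_words: "concat (replicate k c) = concat (replicate k d)"
    using b'd cyc_reduced_pow(1) yc(1) zd(1) by simp
  have "length (concat (replicate k x)) = k * length x" for x :: word
    by (induction k) auto
  then have "k * length c = k * length d"
    using arg_cong[OF eq_words, of length] by (simp only:)
  then have "length c = length d" using k by simp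
  moreover have "\<exists>r s. c @ r = d @ s"
    using k eq_words by (cases k) auto
  ultimately have "c = d"
    by (metis append_eq_append_conv)
  then show ?thesis using a_eq b_eq b'd by simp
qed

subsection \<open>Commuting elements\<close>

lemma intertwine_inv:
  assumes "a \<in> carrier F" "b \<in> carrier F" "y \<in> carrier F" "y \<otimes> a = b \<otimes> y"
  shows "y \<otimes> inv a = inv b \<otimes> y"
proof -
  have "inv b \<otimes> (y \<otimes> a) \<otimes> inv a = inv b \<otimes> (b \<otimes> y) \<otimes> inv a"
    by (simp only: assms(4))
  then show ?thesis using assms(1-3) by (simp add: m_assoc)
qed

text \<open>If \<open>a\<close> and \<open>b\<close> commute and \<open>a @ b\<close> has no
  cancellation, then \<open>a @ b = b @ a\<close> as words, so both are repetitions of one word.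
  Otherwise \<open>inv b\<close> takes the place of \<open>b\<close>; with natural exponents this
  choice carries the sign.\<close>

lemma cyc_reduced_commute:
  assumes a: "cyc_reduced a" "a \<noteq> []" and b: "b \<in> carrier F" and comm: "a \<otimes> b = b \<otimes> a"
  shows "\<exists>i>0::nat. \<exists>j::nat. b [^] i = a [^] j \<or> (inv b) [^] i = a [^] j"
proof -
  have ac: "a \<in> carrier F" using a by (simp add: cyc_reduced_carrier)
  have key: "\<exists>i>0::nat. \<exists>j::nat. b [^] i = a [^] j"
    if b: "b \<in> carrier F" and comm: "a \<otimes> b = b \<otimes> a" and ab: "a @ b \<in> carrier F" for b
  proof -
    have "length (b \<otimes> a) = length b + length a"
      using mult_no_cancel[OF ab] comm by (metis add.commute length_append)
    then have "b @ a \<in> carrier F"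
      using length_mult_eq_iff ac b by blast
    then have "a @ b = b @ a"
      using mult_no_cancel ab comm by metis
    then obtain i j z where z: "concat (replicate i z) = a" "concat (replicate j z) = b"
      using comm_append_are_replicate by blast
    then have "i > 0" using a(2) by (cases i) auto
    \<comment> \<open>Either \<open>z\<close> is \<open>a\<close> itself, or \<open>z @ z\<close> is
      a prefix of \<open>a\<close>.\<close>
    have "z @ z \<in> carrier F"
    proof (cases "i = 1")
      case True
      then show ?thesis using a z by (simp add: cyc_reduced_def)
    next
      case False
      then obtain i' where "i = Suc (Suc i')" using \<open>i > 0\<close> by (cases i rule: nat.exhaust; cases "i - 1") auto
      then show ?thesis using ac z(1) by (auto simp: carrier_append)
    qed
    then have zc: "cyc_reduced z" by (simp add: cyc_reduced_def)
    then have "a = z [^] i" "b = z [^] j" "z \<in> carrier F"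
      using z by (simp_all add: cyc_reduced_pow cyc_reduced_carrier)
    then have "b [^] i = a [^] j"
      by (simp add: nat_pow_pow mult.commute)
    then show ?thesis using \<open>i > 0\<close> by blast
  qed
  show ?thesis
  proof (cases "a @ b \<in> carrier F")
    case True
    then show ?thesis using key[OF b comm] by blast
  next
    case False
    text \<open>If both \<open>b a\<close> and \<open>a b\<^sup>-\<^sup>1\<close> cancelled, then \<open>a\<close> would not be cyclically reduced.\<close>
    then have "length (b \<otimes> a) \<noteq> length b + length a"
      using length_mult_eq_iff[OF ac b] comm by simp
    then have "b @ a \<notin> carrier F"
      using mult_no_cancel[of b a] by auto
    then have "b \<noteq> []" "hd a = inv_letter (last b)"
      using ac b by (auto simp: carrier_append)
    then have "a @ inv b \<in> carrier F"
      using append_inv_carrier_iff[OF ac b] a by (auto simp: cyc_reduced_def carrier_append)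
    moreover have "a \<otimes> inv b = inv b \<otimes> a"
      using intertwine_inv[OF b b ac comm] .
    ultimately show ?thesis using key[of "inv b"] b by blast
  qed
qed

lemma commute_imp_common_power:
  assumes a: "a \<in> carrier F" "a \<noteq> \<one>" and b: "b \<in> carrier F" and comm: "a \<otimes> b = b \<otimes> a"
  shows "\<exists>i>0::nat. \<exists>j::nat. b [^] i = a [^] j \<or> (inv b) [^] i = a [^] j"
proof -
  obtain y c where yc: "cyc_reduced c" "y \<in> carrier F" "a = y @ c @ inv y"
    using cyc_reduced_decomposition[OF a(1)] .
  have c: "c \<in> carrier F" by (simp add: yc cyc_reduced_carrier)
  have a_eq: "a = y \<otimes> c \<otimes> inv y" using conj_eq_append a yc by simp
  define d where "d = inv y \<otimes> b \<otimes> y"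
  have d: "d \<in> carrier F" and b_eq: "b = y \<otimes> d \<otimes> inv y"
    using b yc(2) by (simp_all add: d_def m_assoc)
  have inv_b: "inv b = y \<otimes> inv d \<otimes> inv y"
    using d yc(2) unfolding b_eq by (simp add: inv_mult_group m_assoc)
  have "c \<noteq> []" using a a_eq yc by (auto simp: one_eq[symmetric])
  moreover have "c \<otimes> d = d \<otimes> c"
    using comm c d yc(2) unfolding a_eq b_eq by (simp add: m_assoc) (simp flip: m_assoc)
  ultimately obtain i j :: nat where "i > 0" "d [^] i = c [^] j \<or> (inv d) [^] i = c [^] j"
    using cyc_reduced_commute[OF yc(1) _ d] by blast
  then have "b [^] i = a [^] j \<or> (inv b) [^] i = a [^] j"
    unfolding inv_b unfolding a_eq b_eq using c d yc(2) by (simp only: conj_pow inv_closed) metis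
  then show ?thesis using \<open>i > 0\<close> by blast
qed

text \<open>This takes the role of cyclic centralizers. Some positive power of \<open>c\<close> or
  of \<open>inv c\<close> is a power of \<open>u\<close>, hence fixed by \<sigma>; uniqueness of
  roots descends from the power to \<open>c\<close>.\<close>

lemma hom_fixes_centralizer:
  assumes \<sigma>: "\<sigma> \<in> hom F F" and u: "u \<in> carrier F" "u \<noteq> \<one>" "\<sigma> u = u"
    and c: "c \<in> carrier F" "u \<otimes> c = c \<otimes> u"
  shows "\<sigma> c = c"
proof -
  interpret \<sigma>: group_hom F F \<sigma>
    by unfold_locales (rule \<sigma>)
  obtain i j :: nat where ij: "i > 0" "c [^] i = u [^] j \<or> (inv c) [^] i = u [^] j"
    using commute_imp_common_power[OF u(1,2) c] by blast
  have "\<sigma> (u [^] j) = u [^] j"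
    using u by (simp add: \<sigma>.hom_nat_pow)
  then have "(\<sigma> c) [^] i = c [^] i \<or> (inv (\<sigma> c)) [^] i = (inv c) [^] i"
    using ij(2) c \<sigma>.hom_nat_pow[of c i] \<sigma>.hom_nat_pow[of "inv c" i] by auto
  then have "\<sigma> c = c \<or> inv (\<sigma> c) = inv c"
    using pow_inject[OF _ _ _ ij(1)] c by (metis \<sigma>.hom_closed inv_closed)
  then show ?thesis using c by (metis \<sigma>.hom_closed inv_inv)
qed

text \<open>Conjugation by \<open>y\<close> is a homomorphism fixing the nontrivial
  \<open>z\<close>, so it fixes everything that commutes with \<open>z\<close>.\<close>

lemma commute_trans:
  assumes z: "z \<in> carrier F" "z \<noteq> \<one>" and x: "x \<in> carrier F" "z \<otimes> x = x \<otimes> z"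
    and y: "y \<in> carrier F" "z \<otimes> y = y \<otimes> z"
  shows "x \<otimes> y = y \<otimes> x"
proof -
  have "(\<lambda>w. inv y \<otimes> w \<otimes> y) \<in> hom F F"
    using y by (auto intro!: homI simp: m_assoc)
  then have "inv y \<otimes> x \<otimes> y = x"
    using hom_fixes_centralizer[of "\<lambda>w. inv y \<otimes> w \<otimes> y" z x] assms by (simp add: m_assoc)
  then have "y \<otimes> (inv y \<otimes> x \<otimes> y) = y \<otimes> x" by simp
  then show ?thesis
    using x y by (simp add: m_assoc)
qed

subsection \<open>Short conjugators\<close>

text \<open>A shortest conjugator longer than \<open>d\<close> would begin with \<open>d\<close> or
  with \<open>inv d\<close>, and deleting this prefix leaves a shorter conjugator. The claim
  \<open>key\<close> has its own \<open>c\<close> and \<open>d\<close> so that it applies to their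
  inverses as well.\<close>

lemma cyc_reduced_short_conjugator:
  assumes c: "cyc_reduced c" and d: "cyc_reduced d"
    and Z: "Z \<in> carrier F" "Z \<otimes> c = d \<otimes> Z"
  shows "\<exists>Y\<in>carrier F. Y \<otimes> c = d \<otimes> Y \<and> length Y \<le> length d"
proof -
  have cc: "c \<in> carrier F" and dc: "d \<in> carrier F"
    using c d by (simp_all add: cyc_reduced_carrier)
  define Y where "Y = arg_min length (\<lambda>Y. Y \<in> carrier F \<and> Y \<otimes> c = d \<otimes> Y)"
  have Y: "Y \<in> carrier F" "Y \<otimes> c = d \<otimes> Y"
    using arg_min_natI[of "\<lambda>Y. Y \<in> carrier F \<and> Y \<otimes> c = d \<otimes> Y" Z length] Z by (auto simp: Y_def)
  have min: "length Y \<le> length Y'" if "Y' \<in> carrier F" "Y' \<otimes> c = d \<otimes> Y'" for Y'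
    using arg_min_nat_le[of "\<lambda>Y. Y \<in> carrier F \<and> Y \<otimes> c = d \<otimes> Y" Y' length] that by (simp add: Y_def)
  have Yi: "Y \<otimes> inv c = inv d \<otimes> Y"
    using intertwine_inv[OF cc dc Y] .
  text \<open>A conjugation without cancellation on the left has none on the right either, since the
    other sign would make the lengths of \<open>c\<close> and \<open>d\<close> contradictory.\<close>
  have key: "length Y \<le> length d"
    if c: "cyc_reduced c" and d: "cyc_reduced d" and eq: "Y \<otimes> c = d \<otimes> Y"
      and dY: "d @ Y \<in> carrier F" and eqi: "Y \<otimes> inv c = inv d \<otimes> Y"
      and min: "\<And>Y'. Y' \<in> carrier F \<Longrightarrow> Y' \<otimes> c = d \<otimes> Y' \<Longrightarrow> length Y \<le> length Y'" for c d
  proof (rule ccontr)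
    assume long: "\<not> length Y \<le> length d"
    have cc: "c \<in> carrier F" and dc: "d \<in> carrier F"
      using c d by (simp_all add: cyc_reduced_carrier)
    have len: "length (Y \<otimes> c) = length d + length Y"
      using mult_no_cancel[OF dY] eq by simp
    show False
    proof (cases "Y @ c \<in> carrier F")
      case True
      then have "Y @ c = d @ Y"
        using mult_no_cancel dY eq by metis
      then obtain Y' where Y': "Y = d @ Y'"
        using long by (metis append_eq_append_conv_if linear append_take_drop_id)
      then have Y'c: "Y' \<in> carrier F" using Y(1) by (simp add: carrier_append)
      have "Y = d \<otimes> Y'" using Y' Y(1) mult_no_cancel by metis
      then have "Y' \<otimes> c = d \<otimes> Y'"
        using eq Y'c cc dc by (simp add: m_assoc)
      then have "length Y \<le> length Y'" using min Y'c by blast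
      \<comment> \<open>Minimality forbids a proper shortening, so \<open>d\<close> is empty. Then
        \<open>c\<close> is trivial too, and the empty word is a shorter conjugator after
        all.\<close>
      then have "d = []" using Y' by simp
      then have "[] \<otimes> c = d \<otimes> []"
        using eq Y(1) cc by (simp add: one_eq[symmetric] )
      then show False using min[of "[]"] long one_closed by (simp add: one_eq)
    next
      case False
      then have "length (Y \<otimes> c) < length Y + length c"
        using length_mult_eq_iff[OF Y(1) cc] length_mult_le[of Y c] by linarith
      moreover have "Y \<otimes> inv c = Y @ inv c"
      proof (rule mult_no_cancel)
        show "Y @ inv c \<in> carrier F"
          using False c Y(1) cc append_inv_carrier_iff[OF Y(1) cc]
          by (auto simp: cyc_reduced_def carrier_append)
      qed
      then have "length Y + length c \<le> length d + length Y"
        using eqi length_mult_le[of "inv d" Y] cc dc by (metis length_append length_inv)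
      ultimately show False using len by simp
    qed
  qed
  show ?thesis
  proof (cases "d @ Y \<in> carrier F")
    case True
    then show ?thesis using key[OF c d Y(2) True Yi] min Y by blast
  next
    case False
    then have "Y \<noteq> []" "d \<noteq> []" "hd Y = inv_letter (last d)" using Y(1) dc by (auto simp: carrier_append)
    then have "inv d @ Y \<in> carrier F"
      using inv_append_carrier_iff[OF dc Y(1)] d by (auto simp: cyc_reduced_def carrier_append)
    moreover have "length Y \<le> length Y'"
      if Y': "Y' \<in> carrier F" "Y' \<otimes> inv c = inv d \<otimes> Y'" for Y'
    proof -
      have "Y' \<otimes> c = d \<otimes> Y'"
        using intertwine_inv[of "inv c" "inv d" Y'] Y' cc dc by simp
      then show ?thesis using min Y' by blast
    qed
    ultimately have "length Y \<le> length (inv d)"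
      using key[of "inv c" "inv d"] cyc_reduced_inv c d Yi Y cc dc by simp
    then show ?thesis using Y dc by auto
  qed
qed

lemma short_conjugator:
  assumes u: "u \<in> carrier F" and v: "v \<in> carrier F" and X: "X \<in> carrier F" "X \<otimes> u = v \<otimes> X"
  shows "\<exists>Y\<in>carrier F. Y \<otimes> u = v \<otimes> Y \<and> length Y \<le> length u + length v"
proof -
  obtain x c where xc: "cyc_reduced c" "x \<in> carrier F" "u = x @ c @ inv x"
    using cyc_reduced_decomposition[OF u] .
  obtain y d where yd: "cyc_reduced d" "y \<in> carrier F" "v = y @ d @ inv y"
    using cyc_reduced_decomposition[OF v] .
  have c: "c \<in> carrier F" and d: "d \<in> carrier F"
    using xc yd by (simp_all add: cyc_reduced_carrier)
  have u_eq: "u = x \<otimes> c \<otimes> inv x" and v_eq: "v = y \<otimes> d \<otimes> inv y"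
    using conj_eq_append u v xc yd by simp_all
  have "(inv y \<otimes> X \<otimes> x) \<otimes> c = inv y \<otimes> (X \<otimes> u) \<otimes> x"
    using X(1) xc(2) yd(2) c by (simp add: u_eq m_assoc)
  also have "\<dots> = d \<otimes> (inv y \<otimes> X \<otimes> x)"
    using X xc(2) yd(2) d by (simp add: X(2)) (simp add: v_eq m_assoc)
  finally obtain Z where Z: "Z \<in> carrier F" "Z \<otimes> c = d \<otimes> Z" "length Z \<le> length d"
    using cyc_reduced_short_conjugator[OF xc(1) yd(1), of "inv y \<otimes> X \<otimes> x"] X xc yd by auto
  have "(y \<otimes> Z \<otimes> inv x) \<otimes> u = y \<otimes> (Z \<otimes> c) \<otimes> inv x"
    using Z(1) xc(2) yd(2) c by (simp add: u_eq m_assoc)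
  also have "\<dots> = v \<otimes> (y \<otimes> Z \<otimes> inv x)"
    using Z xc(2) yd(2) d by (simp add: Z(2)) (simp add: v_eq m_assoc)
  finally have "(y \<otimes> Z \<otimes> inv x) \<otimes> u = v \<otimes> (y \<otimes> Z \<otimes> inv x)" .
  moreover have "length (y \<otimes> Z \<otimes> inv x) \<le> length u + length v"
    using length_mult_le[of "y \<otimes> Z" "inv x"] length_mult_le[of y Z] Z(3) xc yd by simp
  ultimately show ?thesis using Z(1) xc(2) yd(2) by blast
qed

end

subsection \<open>Bounded cancellation\<close>

context finite_rank_free_group
begin

lemma letter_bound:
  fixes f :: "word \<Rightarrow> nat"
  shows "\<exists>L. \<forall>a. [a] \<in> carrier F \<longrightarrow> f [a] \<le> L"
proof -
  have "f [a] \<le> (\<Sum>b\<in>{..<n} \<times> UNIV. f [b])" if "[a] \<in> carrier F" for a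
    using that by (intro member_le_sum) (auto simp: carrier_iff words_def)
  then show ?thesis by blast
qed

lemma subadditive_linear_bound:
  fixes f :: "word \<Rightarrow> nat"
  assumes one: "f \<one> = 0"
    and mult: "\<And>x y. x \<in> carrier F \<Longrightarrow> y \<in> carrier F \<Longrightarrow> f (x \<otimes> y) \<le> f x + f y"
    and letter: "\<And>a. [a] \<in> carrier F \<Longrightarrow> f [a] \<le> L"
    and x: "x \<in> carrier F"
  shows "f x \<le> L * length x"
  using x
proof (induction x)
  case Nil
  then show ?case using one by (simp add: one_eq)
next
  case (Cons a x)
  then have ax: "[a] @ x \<in> carrier F" by simp
  then have "[a] \<in> carrier F" "x \<in> carrier F" by (simp_all only: carrier_append)
  then show ?case
    using Cons.IH mult[of "[a]" x] letter[of a] mult_no_cancel[OF ax] by simp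
qed

text \<open>In the Cayley tree, a path with jumps at most \<open>L\<close> passes within \<open>L\<close> of every vertex of the
  geodesic between its endpoints.\<close>
lemma path_crosses_geodesic:
  assumes \<psi>: "\<psi> \<in> hom F F" and L: "\<And>a. [a] \<in> carrier F \<Longrightarrow> length (\<psi> [a]) \<le> L"
    and x: "x \<in> carrier F" and q: "q \<in> carrier F"
    and between: "length (\<psi> x) = length q + length (inv q \<otimes> \<psi> x)"
  shows "\<exists>i. length (inv q \<otimes> \<psi> (take i x)) \<le> L"
proof -
  interpret \<psi>: group_hom F F \<psi>
    by unfold_locales (rule \<psi>)
  define y where "y i = inv q \<otimes> \<psi> (take i x)" for i
  have y: "y i \<in> carrier F" for i
    using q x by (simp add: y_def carrier_take)
  have y0: "y 0 = inv q"
    using q \<psi>.hom_one by (simp add: y_def one_eq[symmetric])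
  have yN: "y (length x) = inv q \<otimes> \<psi> x"
    by (simp add: y_def)
  show ?thesis
  proof (cases "q = []")
    case True
    then have "length (y 0) \<le> L"
      using y0 q by (metis length_inv list.size(3) le0)
    then show ?thesis unfolding y_def by blast
  next
    case False
    \<comment> \<open>Translation by \<open>inv q\<close> moves the vertex \<open>q\<close> to the
      identity, and \<open>P\<close> says that the path is still in the branch where it started. A
      step that leaves this branch jumps across the identity, so its length is the sum of the
      distances of its two ends from there.\<close>
    define P where "P i \<longleftrightarrow> y i \<noteq> [] \<and> hd (y i) = hd (y 0)" for i
    have y0_ne: "y 0 \<noteq> []"
      using False y0 q by (metis length_inv length_0_conv)
    have "q @ (inv q \<otimes> \<psi> x) \<in> carrier F"
      using length_mult_eq_iff[of q "inv q \<otimes> \<psi> x"] q x between by simp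
    then have "inv (y 0) @ y (length x) \<in> carrier F"
      using q by (simp add: yN y0)
    then have "\<not> P (length x)"
      using inv_append_carrier_iff[OF y y, of 0 "length x"] y0_ne by (auto simp: P_def)
    moreover have "P 0" using y0_ne by (simp add: P_def)
    ultimately obtain i where i: "i < length x" "P i" "\<not> P (Suc i)"
      using inc_induct[of 0 "length x" "\<lambda>i. \<not> P i"] by blast
    have xi: "take (Suc i) x = take i x \<otimes> [x ! i]" "[x ! i] \<in> carrier F"
      using take_Suc_mult[OF x i(1)] .
    have "inv (y i) \<otimes> y (Suc i) = \<psi> [x ! i]"
      using xi x q by (simp add: y_def carrier_take inv_mult_group m_assoc)
    moreover have "inv (y i) @ y (Suc i) \<in> carrier F"
      using inv_append_carrier_iff[OF y y, of i "Suc i"] i(2,3) by (auto simp: P_def)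
    ultimately have "length (y i) \<le> L"
      using L[OF xi(2)] mult_no_cancel[of "inv (y i)" "y (Suc i)"] y[of i]
      by (metis add_leD1 length_append length_inv)
    then show ?thesis unfolding y_def by blast
  qed
qed

text \<open>The inverse automorphism sends the prefixes of \<open>\<phi> (a \<otimes> b)\<close> to
  a path from 1 to \<open>a \<otimes> b\<close>, which must pass near \<open>a\<close>. Applying
  \<phi> again, \<open>\<phi> a\<close> is within \<open>L * L'\<close> of a prefix, and
  \<open>\<phi> b\<close> is as close to the complementary suffix; the lengths of prefix and suffix
  add up exactly.\<close>

lemma bounded_cancellation:
  assumes \<phi>: "\<phi> \<in> hom F F" and bij: "bij_betw \<phi> (carrier F) (carrier F)"
  shows "\<exists>C. \<forall>a b. a @ b \<in> carrier F \<longrightarrow> length (\<phi> a) + length (\<phi> b) \<le> length (\<phi> (a \<otimes> b)) + C"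
proof -
  interpret \<phi>: group_hom F F \<phi>
    by unfold_locales (rule \<phi>)
  define \<psi> where "\<psi> = inv_into (carrier F) \<phi>"
  have "\<phi> \<in> iso F F" using \<phi> bij by (simp add: iso_def)
  then have \<psi>: "\<psi> \<in> hom F F"
    using iso_set_sym unfolding \<psi>_def iso_def by blast
  have \<psi>\<phi>: "\<psi> (\<phi> x) = x" if "x \<in> carrier F" for x
    using bij that by (simp add: \<psi>_def bij_betw_def inv_into_f_f)
  have \<phi>\<psi>: "\<phi> (\<psi> x) = x" if "x \<in> carrier F" for x
    using bij that by (simp add: \<psi>_def bij_betw_def f_inv_into_f)
  obtain L where L: "\<And>a. [a] \<in> carrier F \<Longrightarrow> length (\<phi> [a]) \<le> L"
    using letter_bound[of "\<lambda>x. length (\<phi> x)"] by auto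
  obtain L' where L': "\<And>a. [a] \<in> carrier F \<Longrightarrow> length (\<psi> [a]) \<le> L'"
    using letter_bound[of "\<lambda>x. length (\<psi> x)"] by auto
  have lip: "length (\<phi> x) \<le> L * length x" if "x \<in> carrier F" for x
    using that by (intro subadditive_linear_bound[of "\<lambda>x. length (\<phi> x)"])
      (auto simp: L length_mult_le \<phi>.hom_one, simp add: one_eq)
  have "length (\<phi> a) + length (\<phi> b) \<le> length (\<phi> (a \<otimes> b)) + 2 * (L * L')"
    if ab: "a @ b \<in> carrier F" for a b
  proof -
    have a: "a \<in> carrier F" and b: "b \<in> carrier F"
      using ab by (simp_all add: carrier_append)
    define x where "x = \<phi> (a \<otimes> b)"
    have x: "x \<in> carrier F" using a b by (simp add: x_def)
    have "\<psi> x = a \<otimes> b" unfolding x_def using a b by (intro \<psi>\<phi>) simp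
    then have "length (\<psi> x) = length a + length (inv a \<otimes> \<psi> x)"
      using a b length_mult_eq_iff[OF a b] ab by simp
    then obtain i where i: "length (inv a \<otimes> \<psi> (take i x)) \<le> L'"
      using path_crosses_geodesic[OF \<psi> L' x a] by blast
    let ?p = "take i x" and ?s = "drop i x"
    have ps: "?p \<in> carrier F" "?s \<in> carrier F" "?p \<otimes> ?s = x"
      using x by (simp_all add: carrier_take carrier_drop take_mult_drop)
    have \<psi>p: "\<psi> ?p \<in> carrier F" using ps \<psi> by (auto simp: hom_def)
    have d: "inv (\<phi> a) \<otimes> ?p \<in> carrier F" using a ps by simp
    have "length (inv (\<phi> a) \<otimes> ?p) = length (\<phi> (inv a \<otimes> \<psi> ?p))"
      using a ps \<psi>p by (simp add: \<phi>\<psi>)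
    also have "\<dots> \<le> L * length (inv a \<otimes> \<psi> ?p)"
      using a \<psi>p by (intro lip) simp
    also have "\<dots> \<le> L * L'"
      using i by simp
    finally have D: "length (inv (\<phi> a) \<otimes> ?p) \<le> L * L'" .
    have "\<phi> a = ?p \<otimes> inv (inv (\<phi> a) \<otimes> ?p)"
      using a ps by (simp add: inv_mult_group m_assoc[symmetric])
    then have 1: "length (\<phi> a) \<le> length ?p + L * L'"
      using length_mult_le[of ?p "inv (inv (\<phi> a) \<otimes> ?p)"] D length_inv[OF d] by simp
    have "\<phi> b = inv (\<phi> a) \<otimes> x"
      using a b by (simp add: x_def)
    also have "\<dots> = (inv (\<phi> a) \<otimes> ?p) \<otimes> ?s"
      using a ps by (simp add: m_assoc)
    finally have 2: "length (\<phi> b) \<le> L * L' + length ?s"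
      using length_mult_le[of "inv (\<phi> a) \<otimes> ?p" ?s] D by simp
    have "length ?p + length ?s = length (\<phi> (a \<otimes> b))"
      unfolding x_def[symmetric] by (metis append_take_drop_id length_append)
    then show ?thesis using 1 2 by simp
  qed
  then show ?thesis by blast
qed

subsection \<open>Centres of finite sets\<close>

text \<open>Here \<open>wt (x\<^sup>-\<^sup>1 y)\<close> is a left-invariant metric that is nearly additive along geodesics of the
  Cayley tree. If \<open>c\<close> and \<open>d\<close> were far apart, then \<open>P\<close> would have a smaller radius seen from the
  midpoint of the geodesic between them.\<close>
lemma near_centres_close:
  fixes wt :: "word \<Rightarrow> nat"
  assumes one: "wt \<one> = 0"
    and wt_inv: "\<And>x. x \<in> carrier F \<Longrightarrow> wt (inv x) = wt x"
    and mult: "\<And>x y. x \<in> carrier F \<Longrightarrow> y \<in> carrier F \<Longrightarrow> wt (x \<otimes> y) \<le> wt x + wt y"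
    and letter: "\<And>a. [a] \<in> carrier F \<Longrightarrow> wt [a] \<le> L"
    and C: "\<And>a b. a @ b \<in> carrier F \<Longrightarrow> wt a + wt b \<le> wt (a \<otimes> b) + C"
    and P: "P \<subseteq> carrier F"
    and c: "c \<in> carrier F" "\<And>p. p \<in> P \<Longrightarrow> wt (inv c \<otimes> p) \<le> r"
    and minimal: "\<And>q. q \<in> carrier F \<Longrightarrow> \<exists>p\<in>P. r \<le> wt (inv q \<otimes> p)"
    and d: "d \<in> carrier F" "\<And>p. p \<in> P \<Longrightarrow> wt (inv d \<otimes> p) \<le> r + E"
  shows "wt (inv c \<otimes> d) \<le> 2 * (E + L + C)"
proof -
  define w where "w = inv c \<otimes> d"
  have w: "w \<in> carrier F" using c d by (simp add: w_def)
  \<comment> \<open>An index at which \<open>Q\<close> turns false is a midpoint of the geodesic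
    from \<open>c\<close> to \<open>d\<close>, up to the weight of one letter.\<close>
  define Q where "Q i \<longleftrightarrow> 2 * wt (take i w) \<le> wt w" for i
  show ?thesis
  proof (cases "Q (length w)")
    case True
    then show ?thesis by (simp add: Q_def w_def)
  next
    case False
    moreover have "Q 0" using one by (simp add: Q_def one_eq)
    ultimately obtain i where i: "i < length w" "Q i" "\<not> Q (Suc i)"
      using inc_induct[of 0 "length w" "\<lambda>i. \<not> Q i"] by blast
    let ?t = "take i w"
    have t: "?t \<in> carrier F" "drop i w \<in> carrier F" "?t \<otimes> drop i w = w"
      using w by (simp_all add: carrier_take carrier_drop take_mult_drop)
    have half1: "wt w \<le> 2 * (wt ?t + L)"
      using take_Suc_mult[OF w i(1)] mult[of ?t "[w ! i]"] letter[of "w ! i"] i(3) t(1)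
      by (simp add: Q_def)
    have half2: "wt w \<le> 2 * wt (drop i w)"
      using mult[of ?t "drop i w"] t i(2) by (simp add: Q_def)
    define q where "q = c \<otimes> ?t"
    have q: "q \<in> carrier F" using c t by (simp add: q_def)
    obtain p where p: "p \<in> P" "r \<le> wt (inv q \<otimes> p)"
      using minimal[OF q] by blast
    have pc: "p \<in> carrier F" using p P by blast
    define y where "y = inv q \<otimes> p"
    have y: "y \<in> carrier F" using q pc by (simp add: y_def)
    have yc: "inv y \<otimes> inv ?t = inv (inv c \<otimes> p)"
      using c t pc by (simp add: y_def q_def inv_mult_group m_assoc)
    have "c \<otimes> w = d" using c d by (simp add: w_def)
    then have "q \<otimes> drop i w = d"
      using c t by (simp add: q_def m_assoc)
    then have yd: "inv y \<otimes> drop i w = inv (inv d \<otimes> p)"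
      using q pc t d by (metis (no_types, lifting) inv_closed inv_inv inv_mult_group m_assoc y_def)
    have "inv (inv ?t) @ drop i w \<in> carrier F"
      using w t(1) by simp
    then have "inv ?t = [] \<or> drop i w = [] \<or> hd (inv ?t) \<noteq> hd (drop i w)"
      using inv_append_carrier_iff[of "inv ?t" "drop i w"] t by simp
    \<comment> \<open>From the midpoint \<open>q\<close> the directions to \<open>c\<close> and to
      \<open>d\<close> differ, so the direction to \<open>p\<close> differs from one of them, and
      the geodesic from \<open>p\<close> to that end passes through \<open>q\<close>. The end
      \<open>c\<close> yields the bound \<open>2 * (L + C)\<close>, the end \<open>d\<close> yields
      \<open>2 * (E + C)\<close>.\<close>
    then consider "inv y @ inv ?t \<in> carrier F" | "inv y @ drop i w \<in> carrier F"
      using inv_append_carrier_iff[OF y, of "inv ?t"] inv_append_carrier_iff[OF y, of "drop i w"] t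
      by auto
    then show ?thesis
    proof cases
      case 1
      then have "wt y + wt ?t \<le> wt (inv c \<otimes> p) + C"
        using C[of "inv y" "inv ?t"] yc wt_inv y t(1) c(1) pc by simp
      then show ?thesis using c(2)[OF p(1)] p(2) half1 by (simp add: y_def w_def)
    next
      case 2
      then have "wt y + wt (drop i w) \<le> wt (inv d \<otimes> p) + C"
        using C[of "inv y" "drop i w"] yd wt_inv y d(1) pc by simp
      then show ?thesis using d(2)[OF p(1)] p(2) half2 by (simp add: y_def w_def)
    qed
  qed
qed

end

subsection \<open>Twisted conjugacy for a virtually inner automorphism\<close>

locale virtually_inner_aut = finite_rank_free_group +
  fixes \<phi> :: "word \<Rightarrow> word" and m :: nat and g :: word
  assumes \<phi>_hom: "\<phi> \<in> hom F F"
    and \<phi>_bij: "bij_betw \<phi> (carrier F) (carrier F)"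
    and m_pos: "m > 0"
    and g_carrier [simp]: "g \<in> carrier F"
    and \<phi>_g [simp]: "\<phi> g = g"
    and \<phi>_pow_m: "x \<in> carrier F \<Longrightarrow> (\<phi> ^^ m) x = g \<otimes> x \<otimes> inv g"

sublocale virtually_inner_aut \<subseteq> \<phi>: group_hom F F \<phi>
  by unfold_locales (rule \<phi>_hom)

context virtually_inner_aut
begin

section \<open>Iterates of \<phi> and an almost invariant weight\<close>

lemma \<phi>_pow_hom: "\<phi> ^^ k \<in> hom F F"
proof (induction k)
  case 0
  then show ?case by (auto intro!: homI)
next
  case (Suc k)
  then show ?case using \<phi>_hom by (auto simp: hom_def Pi_iff)
qed

lemma \<phi>_pow_bij: "bij_betw (\<phi> ^^ k) (carrier F) (carrier F)"
  by (rule bij_betw_funpow) (rule \<phi>_bij)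

sublocale \<phi>_pow: group_hom F F "\<phi> ^^ k" for k
  by unfold_locales (rule \<phi>_pow_hom)

text \<open>Applying \<phi> shifts the summands: the first one is lost, and the length of a
  conjugate by \<open>g\<close> comes in at the end. This costs at most \<open>2 * length g\<close>,
  independently of the word.\<close>

definition wt :: "word \<Rightarrow> nat" where
  "wt w = (\<Sum>k<m. length ((\<phi> ^^ k) w))"

lemma wt_one: "wt \<one> = 0"
proof -
  have "length \<one> = 0" by (simp add: one_eq)
  then show ?thesis by (simp only: wt_def \<phi>_pow.hom_one) simp
qed

lemma wt_inv: "x \<in> carrier F \<Longrightarrow> wt (inv x) = wt x"
  by (simp add: wt_def \<phi>_pow.hom_inv)

lemma wt_mult: "x \<in> carrier F \<Longrightarrow> y \<in> carrier F \<Longrightarrow> wt (x \<otimes> y) \<le> wt x + wt y"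
  unfolding wt_def sum.distrib[symmetric]
  by (intro sum_mono) (simp add: length_mult_le)

lemma length_le_wt: "length x \<le> wt x"
  unfolding wt_def using member_le_sum[of 0 "{..<m}" "\<lambda>k. length ((\<phi> ^^ k) x)"] m_pos by simp

lemma wt_\<phi>: "x \<in> carrier F \<Longrightarrow> wt (\<phi> x) \<le> wt x + 2 * length g"
proof -
  assume x: "x \<in> carrier F"
  have "wt (\<phi> x) = (\<Sum>k<m. length ((\<phi> ^^ Suc k) x))"
    by (simp add: wt_def funpow_swap1)
  also have "length x + \<dots> = (\<Sum>k<Suc m. length ((\<phi> ^^ k) x))"
    by (subst sum.lessThan_Suc_shift) simp
  also have "\<dots> = wt x + length (g \<otimes> x \<otimes> inv g)"
    by (simp add: wt_def \<phi>_pow_m[OF x])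
  finally show ?thesis
    using length_mult_le[of "g \<otimes> x" "inv g"] length_mult_le[of g x] by simp
qed

lemma wt_bounded_cancellation:
  "\<exists>C. \<forall>a b. a @ b \<in> carrier F \<longrightarrow> wt a + wt b \<le> wt (a \<otimes> b) + C"
proof -
  have "\<exists>C. \<forall>a b. a @ b \<in> carrier F \<longrightarrow>
      length ((\<phi> ^^ k) a) + length ((\<phi> ^^ k) b) \<le> length ((\<phi> ^^ k) (a \<otimes> b)) + C" for k
    by (rule bounded_cancellation[OF \<phi>_pow_hom \<phi>_pow_bij])
  then obtain C where C: "\<And>k a b. a @ b \<in> carrier F \<Longrightarrow>
      length ((\<phi> ^^ k) a) + length ((\<phi> ^^ k) b) \<le> length ((\<phi> ^^ k) (a \<otimes> b)) + C k"
    by metis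
  have "wt a + wt b \<le> wt (a \<otimes> b) + (\<Sum>k<m. C k)" if "a @ b \<in> carrier F" for a b
    unfolding wt_def sum.distrib[symmetric] using C[OF that] by (intro sum_mono)
  then show ?thesis by blast
qed

lemma wt_linear_bound: "\<exists>L. \<forall>x\<in>carrier F. wt x \<le> L * length x"
proof -
  obtain L where "\<And>a. [a] \<in> carrier F \<Longrightarrow> wt [a] \<le> L"
    using letter_bound[of wt] by auto
  then have "wt x \<le> L * length x" if "x \<in> carrier F" for x
    using subadditive_linear_bound[of wt L x] wt_one wt_mult that by blast
  then show ?thesis by blast
qed

section \<open>Twisted norms and obstructions\<close>

primrec norm_word :: "nat \<Rightarrow> word \<Rightarrow> word" where
  "norm_word 0 U = \<one>"
| "norm_word (Suc k) U = \<phi> (norm_word k U) \<otimes> U"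

lemma norm_word_closed [simp]: "U \<in> carrier F \<Longrightarrow> norm_word k U \<in> carrier F"
  by (induction k) simp_all

lemma norm_word_Suc: "U \<in> carrier F \<Longrightarrow> norm_word (Suc k) U = (\<phi> ^^ k) U \<otimes> norm_word k U"
proof (induction k)
  case (Suc k)
  then have "norm_word (Suc (Suc k)) U = \<phi> ((\<phi> ^^ k) U \<otimes> norm_word k U) \<otimes> U"
    by simp
  also have "\<dots> = (\<phi> ^^ Suc k) U \<otimes> norm_word (Suc k) U"
    using Suc.prems \<phi>_pow.hom_closed[of U k] by (simp add: m_assoc)
  finally show ?case .
qed simp

lemma wt_norm_word:
  assumes "U \<in> carrier F"
  shows "wt (norm_word k U) \<le> k * (wt U + 2 * length g)"
proof (induction k)
  case (Suc k)
  have "wt (norm_word (Suc k) U) \<le> wt (norm_word k U) + 2 * length g + wt U"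
    using wt_mult[of "\<phi> (norm_word k U)" U] wt_\<phi>[of "norm_word k U"] assms by simp
  then show ?case using Suc by simp
qed (simp add: wt_one)

definition obstruction :: "word \<Rightarrow> word" where
  "obstruction U = inv g \<otimes> norm_word m U"

lemma obstruction_closed [simp]: "U \<in> carrier F \<Longrightarrow> obstruction U \<in> carrier F"
  by (simp add: obstruction_def)

text \<open>Expand \<open>norm_word (Suc m) U\<close> from either end; at the left end the power of
  \<phi> is conjugation by \<open>g\<close>. Thus the obstruction is a fixed point of
  \<open>y \<mapsto> inv U \<otimes> \<phi> y \<otimes> U\<close>.\<close>

lemma \<phi>_obstruction:
  assumes "U \<in> carrier F"
  shows "\<phi> (obstruction U) \<otimes> U = U \<otimes> obstruction U"
proof -
  have "\<phi> (obstruction U) \<otimes> U = inv g \<otimes> norm_word (Suc m) U"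
    using assms by (simp add: obstruction_def m_assoc)
  also have "\<dots> = U \<otimes> obstruction U"
    unfolding norm_word_Suc[OF assms] using assms by (simp add: obstruction_def \<phi>_pow_m m_assoc)
  finally show ?thesis .
qed

text \<open>With \<open>c = \<one>\<close> this iterates a genuine solution. The general defect
  \<open>c\<close> serves the converse, where it has to be shown trivial; \<open>fixed\<close> is
  what moves it past \<open>U\<close> in each round.\<close>

lemma twisted_pow:
  assumes U: "U \<in> carrier F" and V: "V \<in> carrier F" and X: "X \<in> carrier F" and c: "c \<in> carrier F"
    and eq: "\<phi> X \<otimes> U = V \<otimes> X \<otimes> c" and fixed: "\<phi> c \<otimes> U = U \<otimes> c"
  shows "(\<phi> ^^ k) X \<otimes> norm_word k U = norm_word k V \<otimes> X \<otimes> c [^] k"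
proof (induction k)
  case 0
  then show ?case using X by simp
next
  case (Suc k)
  have fixed_pow: "\<phi> (c [^] k) \<otimes> U = U \<otimes> c [^] k" for k :: nat
  proof (induction k)
    case (Suc k)
    have "\<phi> (c [^] Suc k) \<otimes> U = \<phi> (c [^] k) \<otimes> (\<phi> c \<otimes> U)"
      using c U by (simp add: m_assoc)
    also have "\<dots> = (\<phi> (c [^] k) \<otimes> U) \<otimes> c"
      using c U by (simp add: fixed m_assoc)
    also have "\<dots> = U \<otimes> c [^] Suc k"
      using c U by (simp add: Suc m_assoc)
    finally show ?case .
  qed (use U in simp)
  have Xk: "(\<phi> ^^ k) X \<in> carrier F" using X by simp
  have "(\<phi> ^^ Suc k) X \<otimes> norm_word (Suc k) U = \<phi> ((\<phi> ^^ k) X \<otimes> norm_word k U) \<otimes> U"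
    using Xk U by (simp add: m_assoc)
  also have "\<dots> = \<phi> (norm_word k V) \<otimes> \<phi> X \<otimes> (\<phi> (c [^] k) \<otimes> U)"
    unfolding Suc.IH using V X c U by (simp add: m_assoc)
  also have "\<dots> = \<phi> (norm_word k V) \<otimes> (\<phi> X \<otimes> U) \<otimes> c [^] k"
    unfolding fixed_pow using V X c U by (simp add: m_assoc)
  also have "\<dots> = norm_word (Suc k) V \<otimes> X \<otimes> (c \<otimes> c [^] k)"
    unfolding eq using V X c by (simp add: m_assoc)
  also have "c \<otimes> c [^] k = c [^] Suc k"
    using c by (metis nat_pow_Suc2)
  finally show ?case .
qed

lemma obstruction_twisted:
  assumes U: "U \<in> carrier F" and V: "V \<in> carrier F" and X: "X \<in> carrier F" and c: "c \<in> carrier F"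
    and eq: "\<phi> X \<otimes> U = V \<otimes> X \<otimes> c" and fixed: "\<phi> c \<otimes> U = U \<otimes> c"
  shows "X \<otimes> obstruction U = obstruction V \<otimes> X \<otimes> c [^] m"
proof -
  have "g \<otimes> (X \<otimes> obstruction U) = (\<phi> ^^ m) X \<otimes> norm_word m U"
    using X U by (simp add: \<phi>_pow_m obstruction_def m_assoc)
  also have "\<dots> = norm_word m V \<otimes> X \<otimes> c [^] m"
    by (rule twisted_pow[OF assms])
  also have "\<dots> = g \<otimes> (obstruction V \<otimes> X \<otimes> c [^] m)"
    using V X c by (simp add: obstruction_def m_assoc)
  finally show ?thesis using X U V c by simp
qed

text \<open>The defect \<open>c\<close> of \<open>X\<close> centralizes the obstruction of \<open>U\<close>, so it is fixed by \<open>y \<mapsto> U\<^sup>-\<^sup>1 \<phi>(y) U\<close>.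
  Iterating \<open>m\<close> times gives \<open>c\<^sup>m = 1\<close>.\<close>
lemma twisted_if_obstruction_conjugate:
  assumes U: "U \<in> carrier F" and V: "V \<in> carrier F" and X: "X \<in> carrier F"
    and nontrivial: "obstruction U \<noteq> \<one>"
    and conj: "X \<otimes> obstruction U = obstruction V \<otimes> X"
  shows "\<phi> X \<otimes> U = V \<otimes> X"
proof -
  define T where "T = inv V \<otimes> \<phi> X \<otimes> U"
  define c where "c = inv X \<otimes> T"
  have T: "T \<in> carrier F" and c: "c \<in> carrier F" using U V X by (simp_all add: T_def c_def)
  have eq: "\<phi> X \<otimes> U = V \<otimes> X \<otimes> c"
    using U V X by (simp add: c_def T_def m_assoc)
  \<comment> \<open>Applying \<phi> to the conjugation by \<open>X\<close>, with
    \<open>\<phi>_obstruction\<close> for both words, shows that \<open>T\<close> conjugates the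
    obstructions just as \<open>X\<close> does. Their quotient \<open>c\<close> therefore
    centralizes \<open>obstruction U\<close>.\<close>
  have "V \<otimes> (T \<otimes> obstruction U) = \<phi> X \<otimes> (U \<otimes> obstruction U)"
    using U V X by (simp add: T_def m_assoc)
  also have "\<dots> = \<phi> (X \<otimes> obstruction U) \<otimes> U"
    unfolding \<phi>_obstruction[OF U, symmetric] using U X by (simp add: m_assoc)
  also have "\<dots> = \<phi> (obstruction V) \<otimes> V \<otimes> T"
    unfolding conj using U V X by (simp add: T_def m_assoc)
  also have "\<dots> = V \<otimes> (obstruction V \<otimes> T)"
    unfolding \<phi>_obstruction[OF V] using V T by (simp add: m_assoc)
  finally have "T \<otimes> obstruction U = obstruction V \<otimes> T"
    using U V T by simp
  then have "X \<otimes> (c \<otimes> obstruction U) = (obstruction V \<otimes> X) \<otimes> c"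
    using X T U V by (simp add: c_def m_assoc)
  then have "X \<otimes> (c \<otimes> obstruction U) = X \<otimes> (obstruction U \<otimes> c)"
    unfolding conj[symmetric] using X U c by (simp add: m_assoc)
  then have comm: "obstruction U \<otimes> c = c \<otimes> obstruction U"
    using X U c by simp
  have "(\<lambda>y. inv U \<otimes> \<phi> y \<otimes> U) \<in> hom F F"
    using U by (auto intro!: homI simp: m_assoc)
  moreover have "inv U \<otimes> \<phi> (obstruction U) \<otimes> U = obstruction U"
    using \<phi>_obstruction[OF U] U by (simp add: m_assoc)
  ultimately have "inv U \<otimes> \<phi> c \<otimes> U = c"
    by (rule hom_fixes_centralizer[OF _ obstruction_closed[OF U] nontrivial _ c comm])
  then have "U \<otimes> (inv U \<otimes> \<phi> c \<otimes> U) = U \<otimes> c" by simp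
  then have fixed: "\<phi> c \<otimes> U = U \<otimes> c"
    using U c by (simp add: m_assoc)
  have "obstruction V \<otimes> X \<otimes> c [^] m = obstruction V \<otimes> X"
    using obstruction_twisted[OF U V X c eq fixed] conj by simp
  then have "c [^] m = \<one>"
    using V X c by (metis l_cancel_one' m_closed obstruction_closed nat_pow_closed)
  then have "c = \<one>" using pow_eq_one_imp[OF c _ m_pos] by simp
  then show ?thesis using eq V X by simp
qed

text \<open>If the obstruction of \<open>U\<close> vanishes, then the quasi-isometry \<open>S: Y \<mapsto> U\<^sup>-\<^sup>1 \<phi>(Y)\<close> of the Cayley tree
  has the nearly periodic orbit \<open>S\<^sup>k(1) = norm_word k U\<^sup>-\<^sup>1\<close>; its centre is nearly fixed by \<open>S\<close>.\<close>
lemma short_representative: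
  "\<exists>K A. \<forall>U\<in>carrier F. obstruction U = \<one> \<longrightarrow>
     (\<exists>X\<in>carrier F. length X \<le> A * Suc (length U) \<and> length (\<phi> X \<otimes> U \<otimes> inv X) \<le> K)"
proof -
  obtain C where C: "\<And>a b. a @ b \<in> carrier F \<Longrightarrow> wt a + wt b \<le> wt (a \<otimes> b) + C"
    using wt_bounded_cancellation by blast
  obtain L where L: "\<And>x. x \<in> carrier F \<Longrightarrow> wt x \<le> L * length x"
    using wt_linear_bound by blast
  \<comment> \<open>The error of one application of \<open>S\<close> to a centre:
    \<open>2 * length g\<close> is the defect of the weight under \<phi>, and \<open>wt g\<close>
    arises because the orbit returns after \<open>m\<close> steps to \<open>inv g\<close> instead of
    1.\<close>
  define E where "E = 2 * length g + wt g"
  define A where "A = m * (L + 2 * length g)"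
  have "\<exists>X\<in>carrier F. length X \<le> A * Suc (length U)
      \<and> length (\<phi> X \<otimes> U \<otimes> inv X) \<le> 2 * (E + L + C)"
    if U: "U \<in> carrier F" and triv: "obstruction U = \<one>" for U
  proof -
    have "g \<otimes> (inv g \<otimes> norm_word m U) = g"
      using triv by (simp add: obstruction_def)
    then have Nm: "norm_word m U = g"
      using U by simp
    define p where "p k = inv (norm_word k U)" for k
    have p: "p k \<in> carrier F" for k using U by (simp add: p_def)
    have p_Suc: "inv U \<otimes> \<phi> (p k) = p (Suc k)" for k
      using U by (simp add: p_def inv_mult_group)
    define r where "r x = Max ((\<lambda>k. wt (inv x \<otimes> p k)) ` {..<m})" for x
    have r_ge: "wt (inv x \<otimes> p k) \<le> r x" if "k < m" for x k
      using that by (simp add: r_def)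
    have r_witness: "\<exists>k<m. r x = wt (inv x \<otimes> p k)" for x
    proof -
      have "r x \<in> (\<lambda>k. wt (inv x \<otimes> p k)) ` {..<m}"
        unfolding r_def using m_pos by (intro Max_in) auto
      then show ?thesis by auto
    qed
    define c where "c = arg_min r (\<lambda>x. x \<in> carrier F)"
    have c: "c \<in> carrier F"
      using arg_min_natI[of "\<lambda>x. x \<in> carrier F" "\<one>" r] by (simp add: c_def)
    have minimal: "r c \<le> r q" if "q \<in> carrier F" for q
      using arg_min_nat_le[of "\<lambda>x. x \<in> carrier F" q r] that by (simp add: c_def)
    define d where "d = inv U \<otimes> \<phi> c"
    have d: "d \<in> carrier F" using U c by (simp add: d_def)
    have dp: "wt (inv d \<otimes> p (Suc k)) \<le> r c + 2 * length g" if "k < m" for k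
    proof -
      have "inv d \<otimes> p (Suc k) = \<phi> (inv c \<otimes> p k)"
        unfolding p_Suc[symmetric] using U c p by (simp add: d_def inv_mult_group m_assoc)
      then show ?thesis
        using wt_\<phi>[of "inv c \<otimes> p k"] r_ge[OF that, of c] c p by simp
    qed
    have dp_all: "wt (inv d \<otimes> p k) \<le> r c + E" if k: "k < m" for k
    proof (cases k)
      case 0
      have "inv d \<otimes> p 0 = (inv d \<otimes> p (Suc (m - 1))) \<otimes> g"
        using d m_pos Nm by (simp add: p_def m_assoc del: norm_word.simps(2))
      then have "wt (inv d \<otimes> p 0) \<le> wt (inv d \<otimes> p (Suc (m - 1))) + wt g"
        using wt_mult[of "inv d \<otimes> p (Suc (m - 1))" g] d p by simp
      then show ?thesis using dp[of "m - 1"] m_pos 0 by (simp add: E_def)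
    next
      case (Suc j)
      then show ?thesis using dp[of j] k by (simp add: E_def)
    qed
    have "wt (inv c \<otimes> d) \<le> 2 * (E + L + C)"
    proof (rule near_centres_close[of wt L C "p ` {..<m}" c "r c" d E])
      show "wt [a] \<le> L" if "[a] \<in> carrier F" for a using L[OF that] by simp
      show "\<exists>x\<in>p ` {..<m}. r c \<le> wt (inv q \<otimes> x)" if "q \<in> carrier F" for q
        using minimal[OF that] r_witness[of q] by auto
    qed (use C c d p r_ge dp_all in \<open>auto simp: wt_one wt_inv wt_mult\<close>)
    then have short: "length (inv c \<otimes> d) \<le> 2 * (E + L + C)"
      using length_le_wt[of "inv c \<otimes> d"] by simp
    \<comment> \<open>The displacement of \<open>c\<close> under \<open>S\<close> is, up to
      inversion, the twisted conjugate of \<open>U\<close> by \<open>inv c\<close>.\<close>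
    have "inv (inv c \<otimes> d) = \<phi> (inv c) \<otimes> U \<otimes> inv (inv c)"
      using c U by (simp add: d_def inv_mult_group m_assoc)
    then have rep: "length (\<phi> (inv c) \<otimes> U \<otimes> inv (inv c)) \<le> 2 * (E + L + C)"
      using short c d length_inv[of "inv c \<otimes> d"] by simp
    obtain k where k: "k < m" "r \<one> = wt (inv \<one> \<otimes> p k)"
      using r_witness[of \<one>] by blast
    \<comment> \<open>Since \<open>p 0\<close> is the identity, the weight of the centre is at most
      the minimal radius, hence at most the radius seen from 1, which norms of \<open>U\<close>
      control.\<close>
    have "wt c = wt (inv c \<otimes> p 0)"
      using c wt_inv[of c] by (simp add: p_def)
    also have "\<dots> \<le> r c" using r_ge m_pos by simp
    also have "\<dots> \<le> r \<one>" using minimal by simp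
    also have "\<dots> = wt (norm_word k U)" using k(2) p U by (simp add: wt_inv p_def)
    also have "\<dots> \<le> k * (wt U + 2 * length g)" by (rule wt_norm_word[OF U])
    also have "\<dots> \<le> m * (L * length U + 2 * length g)"
      using k(1) L[OF U] by (intro mult_mono) auto
    also have "\<dots> \<le> A * Suc (length U)"
      by (simp add: A_def algebra_simps)
    finally have "length (inv c) \<le> A * Suc (length U)"
      using length_le_wt[of c] c by simp
    then show ?thesis using rep c by blast
  qed
  then show ?thesis by blast
qed

theorem twisted_conjugator_linear_bound:
  "\<exists>A. \<forall>U\<in>carrier F. \<forall>V\<in>carrier F. (\<exists>X\<in>carrier F. \<phi> X \<otimes> U = V \<otimes> X) \<longrightarrow>
     (\<exists>X\<in>carrier F. \<phi> X \<otimes> U = V \<otimes> X \<and> length X \<le> A * Suc (length U + length V))"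
proof -
  obtain L where L: "\<And>x. x \<in> carrier F \<Longrightarrow> wt x \<le> L * length x"
    using wt_linear_bound by blast
  obtain K A where KA: "\<And>U. U \<in> carrier F \<Longrightarrow> obstruction U = \<one> \<Longrightarrow>
     \<exists>X\<in>carrier F. length X \<le> A * Suc (length U) \<and> length (\<phi> X \<otimes> U \<otimes> inv X) \<le> K"
    using short_representative by blast
  define B where "B = {w \<in> carrier F. length w \<le> K}"
  have "B \<subseteq> {w. set w \<subseteq> {..<n} \<times> UNIV \<and> length w \<le> K}"
    by (auto simp: B_def carrier_iff words_def)
  then have finB: "finite B"
    by (rule finite_subset) (simp add: finite_lists_length_le)
  \<comment> \<open>One solution is chosen for each of the finitely many pairs in
    \<open>B \<times> B\<close>, and \<open>Q\<close> bounds their lengths. For a pair without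
    solution the value is arbitrary and only enlarges \<open>Q\<close>.\<close>
  define W where "W R S = (SOME X. X \<in> carrier F \<and> \<phi> X \<otimes> R = S \<otimes> X)" for R S
  define Q where "Q = (\<Sum>(R, S)\<in>B \<times> B. length (W R S))"
  define D where "D = m * (L + 2 * length g) + length g"
  have obs_len: "length (obstruction U) \<le> D * Suc (length U)" if U: "U \<in> carrier F" for U
  proof -
    have "length (obstruction U) \<le> length g + length (norm_word m U)"
      using length_mult_le[of "inv g" "norm_word m U"] by (simp add: obstruction_def)
    also have "length (norm_word m U) \<le> m * (wt U + 2 * length g)"
      using length_le_wt wt_norm_word[OF U] le_trans by blast
    also have "\<dots> \<le> m * (L * length U + 2 * length g)"
      using L[OF U] by (intro mult_mono) auto
    finally show ?thesis by (simp add: D_def algebra_simps)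
  qed
  have "\<exists>X\<in>carrier F. \<phi> X \<otimes> U = V \<otimes> X \<and> length X \<le> (2 * D + 2 * A + Q) * Suc (length U + length V)"
    if U: "U \<in> carrier F" and V: "V \<in> carrier F" and X: "X \<in> carrier F" "\<phi> X \<otimes> U = V \<otimes> X" for U V X
  proof -
    have conj: "X \<otimes> obstruction U = obstruction V \<otimes> X"
      using obstruction_twisted[OF U V X(1) one_closed] X U V by simp
    show ?thesis
    proof (cases "obstruction U = \<one>")
      case False
      obtain Y where Y: "Y \<in> carrier F" "Y \<otimes> obstruction U = obstruction V \<otimes> Y"
          "length Y \<le> length (obstruction U) + length (obstruction V)"
        using short_conjugator[of "obstruction U" "obstruction V" X] U V X(1) conj by auto
      have "length Y \<le> D * Suc (length U) + D * Suc (length V)"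
        using Y(3) obs_len[OF U] obs_len[OF V] by linarith
      also have "\<dots> \<le> (2 * D + 2 * A + Q) * Suc (length U + length V)"
        by (simp add: algebra_simps)
      finally show ?thesis
        using twisted_if_obstruction_conjugate[OF U V Y(1) False Y(2)] Y(1) by blast
    next
      case True
      then have "\<one> \<otimes> X = obstruction V \<otimes> X"
        using conj X(1) by simp
      then have "obstruction V = \<one>"
        using X(1) V by simp
      then obtain Z where Z: "Z \<in> carrier F" "length Z \<le> A * Suc (length V)"
          "length (\<phi> Z \<otimes> V \<otimes> inv Z) \<le> K"
        using KA[OF V] by blast
      obtain Y where Y: "Y \<in> carrier F" "length Y \<le> A * Suc (length U)"
          "length (\<phi> Y \<otimes> U \<otimes> inv Y) \<le> K"
        using KA[OF U True] by blast
      define R where "R = \<phi> Y \<otimes> U \<otimes> inv Y"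
      define S where "S = \<phi> Z \<otimes> V \<otimes> inv Z"
      have R: "R \<in> B" and S: "S \<in> B" using Y Z U V by (simp_all add: R_def S_def B_def)
      \<comment> \<open>\<open>X\<close> is transported to the short pair \<open>R\<close>,
        \<open>S\<close> only to see that this pair is solvable. The chosen solution, whose length
        is bounded, is then transported back.\<close>
      have "\<phi> (Z \<otimes> X \<otimes> inv Y) \<otimes> R = \<phi> Z \<otimes> (\<phi> X \<otimes> U) \<otimes> inv Y"
        using X(1) Y(1) Z(1) U by (simp add: R_def m_assoc)
      also have "\<dots> = S \<otimes> (Z \<otimes> X \<otimes> inv Y)"
        unfolding X(2) using X(1) Y(1) Z(1) V by (simp add: S_def m_assoc)
      finally have "W R S \<in> carrier F \<and> \<phi> (W R S) \<otimes> R = S \<otimes> W R S"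
        unfolding W_def using X(1) Y(1) Z(1)
        by (intro someI[where P = "\<lambda>X. X \<in> carrier F \<and> \<phi> X \<otimes> R = S \<otimes> X"
              and x = "Z \<otimes> X \<otimes> inv Y"] conjI) simp_all
      then have W: "W R S \<in> carrier F" "\<phi> (W R S) \<otimes> R = S \<otimes> W R S" by auto
      define X' where "X' = inv Z \<otimes> W R S \<otimes> Y"
      have "\<phi> X' \<otimes> U = inv (\<phi> Z) \<otimes> (\<phi> (W R S) \<otimes> R) \<otimes> Y"
        using Y(1) Z(1) U W(1) by (simp add: X'_def R_def m_assoc)
      also have "\<dots> = V \<otimes> X'"
        unfolding W(2) using Y(1) Z(1) V W(1) by (simp add: X'_def S_def m_assoc)
      finally have eq: "\<phi> X' \<otimes> U = V \<otimes> X'" .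
      have "length (W R S) \<le> Q"
        unfolding Q_def
        using member_le_sum[of "(R, S)" "B \<times> B" "\<lambda>(R, S). length (W R S)"] finB R S by simp
      then have "length X' \<le> A * Suc (length V) + Q + A * Suc (length U)"
        using length_mult_le[of "inv Z \<otimes> W R S" Y] length_mult_le[of "inv Z" "W R S"] Y(1,2) Z(1,2)
        by (simp add: X'_def)
      also have "\<dots> \<le> (2 * D + 2 * A + Q) * Suc (length U + length V)"
        by (simp add: algebra_simps)
      finally show ?thesis using eq W(1) Y(1) Z(1) unfolding X'_def by blast
    qed
  qed
  then show ?thesis by blast
qed

end

section \<open>Total recursive functions\<close>

text \<open>Totality at a fixed arity turns the construction of programs into closure rules;
  derivations of \<open>eval\<close> are needed only for the basic ones.\<close>

definition computable :: "nat \<Rightarrow> (nat list \<Rightarrow> nat) \<Rightarrow> bool" where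
  "computable k f \<longleftrightarrow> (\<exists>p. \<forall>xs. length xs = k \<longrightarrow> eval p xs (f xs))"

lemma computable_cong:
  "computable k f \<Longrightarrow> (\<And>xs. length xs = k \<Longrightarrow> f xs = g xs) \<Longrightarrow> computable k g"
  by (auto simp: computable_def)

lemma computable_comp:
  assumes f: "computable (length gs) f" and gs: "\<And>g. g \<in> set gs \<Longrightarrow> computable k g"
  shows "computable k (\<lambda>xs. f (map (\<lambda>g. g xs) gs))"
proof -
  obtain p where p: "\<And>xs. length xs = length gs \<Longrightarrow> eval p xs (f xs)"
    using f by (auto simp: computable_def)
  obtain q where q: "\<And>g xs. g \<in> set gs \<Longrightarrow> length xs = k \<Longrightarrow> eval (q g) xs (g xs)"
    using gs unfolding computable_def by metis
  have "eval (Comp p (map q gs)) xs (f (map (\<lambda>g. g xs) gs))" if "length xs = k" for xs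
    using that by (intro eval_Comp[where ys = "map (\<lambda>g. g xs) gs"] p)
      (auto simp: list_all2_conv_all_nth q)
  then show ?thesis by (auto simp: computable_def)
qed

lemma computable_nth: "i < k \<Longrightarrow> computable k (\<lambda>xs. xs ! i)"
  unfolding computable_def by (auto intro: eval_Proj)

lemma computable_comp1:
  assumes "computable 1 (\<lambda>ys. h (ys ! 0))" "computable k f"
  shows "computable k (\<lambda>xs. h (f xs))"
  using computable_comp[of "[f]" "\<lambda>ys. h (ys ! 0)" k] assms by simp

lemma computable_comp2:
  assumes "computable 2 (\<lambda>ys. h (ys ! 0) (ys ! 1))" "computable k f" "computable k g"
  shows "computable k (\<lambda>xs. h (f xs) (g xs))"
  using computable_comp[of "[f, g]" "\<lambda>ys. h (ys ! 0) (ys ! 1)" k] assms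
  by (auto simp: numeral_2_eq_2)

lemma computable_comp3:
  assumes "computable 3 (\<lambda>ys. h (ys ! 0) (ys ! 1) (ys ! 2))"
    "computable k f" "computable k g" "computable k l"
  shows "computable k (\<lambda>xs. h (f xs) (g xs) (l xs))"
  using computable_comp[of "[f, g, l]" "\<lambda>ys. h (ys ! 0) (ys ! 1) (ys ! 2)" k] assms
  by (auto simp: numeral_3_eq_3)

lemma computable_Suc:
  assumes "computable k f"
  shows "computable k (\<lambda>xs. Suc (f xs))"
proof (rule computable_comp1[of Suc, OF _ assms])
  have "eval Succ xs (Suc (xs ! 0))" if "length xs = 1" for xs
    using that eval_Succ by (cases xs) auto
  then show "computable 1 (\<lambda>ys. Suc (ys ! 0))"
    unfolding computable_def by blast
qed

lemma computable_const: "computable k (\<lambda>_. c)"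
proof (induction c)
  case 0
  then show ?case unfolding computable_def using eval_Zero by blast
qed (rule computable_Suc)

text \<open>Lets a function of the parameters occur in a step function, where value and counter
  precede them.\<close>

lemma computable_drop2:
  assumes "computable k f"
  shows "computable (k + 2) (\<lambda>ys. f (drop 2 ys))"
proof -
  have "computable (k + 2) (\<lambda>ys. f (map (\<lambda>g. g ys) (map (\<lambda>i ys. ys ! (i + 2)) [0..<k])))"
    using assms by (intro computable_comp) (auto intro: computable_nth)
  then show ?thesis
    by (rule computable_cong) (auto intro!: arg_cong[of _ _ f] nth_equalityI simp: add.commute)
qed

text \<open>The two parameters added in the step function are the value and the counter, in this order.\<close>
lemma computable_rec_nat:
  assumes f: "computable k f" and G: "computable (k + 2) (\<lambda>ys. G (ys ! 0) (ys ! 1) (drop 2 ys))"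
    and N: "computable k N"
  shows "computable k (\<lambda>xs. rec_nat (f xs) (\<lambda>j y. G y j xs) (N xs))"
proof -
  obtain p where p: "\<And>xs. length xs = k \<Longrightarrow> eval p xs (f xs)"
    using f by (auto simp: computable_def)
  obtain q where q: "\<And>ys. length ys = k + 2 \<Longrightarrow> eval q ys (G (ys ! 0) (ys ! 1) (drop 2 ys))"
    using G by (auto simp: computable_def)
  have ev: "eval (PrimRec p q) (i # xs) (rec_nat (f xs) (\<lambda>j y. G y j xs) i)" if "length xs = k" for xs i
  proof (induction i)
    case 0
    then show ?case using p[OF that] by (auto intro: eval_PrimRec_0)
  next
    case (Suc i)
    then show ?case
      using q[of "rec_nat (f xs) (\<lambda>j y. G y j xs) i # i # xs"] that
      by (auto intro: eval_PrimRec_Suc)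
  qed
  let ?h = "\<lambda>ys. rec_nat (f (tl ys)) (\<lambda>j y. G y j (tl ys)) (hd ys)"
  have "computable (Suc k) ?h"
    unfolding computable_def
  proof (intro exI[of _ "PrimRec p q"] allI impI)
    fix xs :: "nat list"
    assume "length xs = Suc k"
    then obtain i ys where "xs = i # ys" "length ys = k" by (cases xs) auto
    then show "eval (PrimRec p q) xs (?h xs)" using ev by simp
  qed
  then have "computable k (\<lambda>xs. ?h (map (\<lambda>g. g xs) (N # map (\<lambda>i xs. xs ! i) [0..<k])))"
    using N by (intro computable_comp) (auto intro: computable_nth)
  then show ?thesis
  proof (rule computable_cong)
    fix xs :: "nat list"
    assume "length xs = k"
    then have "map (\<lambda>g. g xs) (map (\<lambda>i xs. xs ! i) [0..<k]) = xs"
      by (auto intro: nth_equalityI)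
    then show "?h (map (\<lambda>g. g xs) (N # map (\<lambda>i xs. xs ! i) [0..<k]))
        = rec_nat (f xs) (\<lambda>j y. G y j xs) (N xs)"
      by simp
  qed
qed

lemma computable_if:
  assumes "computable k c" "computable k f" "computable k g"
  shows "computable k (\<lambda>xs. if c xs = 0 then f xs else g xs)"
proof -
  have "computable k (\<lambda>xs. rec_nat (f xs) (\<lambda>_ _. g xs) (c xs))"
    by (rule computable_rec_nat[where G = "\<lambda>y j. g"]) (intro assms computable_drop2)+
  then show ?thesis
  proof (rule computable_cong)
    fix xs show "rec_nat (f xs) (\<lambda>_ _. g xs) (c xs) = (if c xs = 0 then f xs else g xs)"
      by (cases "c xs") auto
  qed
qed

lemma computable_add:
  assumes "computable k f" "computable k g"
  shows "computable k (\<lambda>xs. f xs + g xs)"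
proof -
  have "rec_nat a (\<lambda>_ y. Suc y) b = a + b" for a b :: nat
    by (induction b) auto
  moreover have "computable k (\<lambda>xs. rec_nat (f xs) (\<lambda>_ y. Suc y) (g xs))"
    by (rule computable_rec_nat[where G = "\<lambda>y j xs. Suc y"])
      (intro assms computable_Suc computable_nth | simp)+
  ultimately show ?thesis by simp
qed

lemma computable_diff:
  assumes "computable k f" "computable k g"
  shows "computable k (\<lambda>xs. f xs - g xs)"
proof -
  have "rec_nat 0 (\<lambda>j _. j) a = a - 1" for a :: nat
    by (cases a) auto
  moreover have "computable 1 (\<lambda>xs. rec_nat 0 (\<lambda>j _. j) (xs ! 0))"
    by (rule computable_rec_nat[where G = "\<lambda>y j xs. j"])
      (intro computable_const computable_nth | simp)+
  ultimately have pred: "computable k (\<lambda>xs. h xs - 1)" if "computable k h" for k h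
    using computable_comp1[of "\<lambda>a. a - 1", OF _ that] by simp
  have "rec_nat a (\<lambda>_ y. y - 1) b = a - b" for a b :: nat
    by (induction b) auto
  moreover have "computable k (\<lambda>xs. rec_nat (f xs) (\<lambda>_ y. y - 1) (g xs))"
    by (rule computable_rec_nat[where G = "\<lambda>y j xs. y - 1"])
      (intro assms pred computable_nth | simp)+
  ultimately show ?thesis by simp
qed

lemma computable_mult_const:
  assumes "computable k f"
  shows "computable k (\<lambda>xs. c * f xs)"
proof (induction c)
  case (Suc c)
  then show ?case using computable_add[OF assms Suc] by simp
qed (simp add: computable_const)

lemma computable_if_le:
  assumes "computable k a" "computable k b" "computable k f" "computable k g"
  shows "computable k (\<lambda>xs. if a xs \<le> b xs then f xs else g xs)"
  using computable_if[OF computable_diff[OF assms(1,2)] assms(3,4)] by simp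

lemma computable_if_eq:
  assumes "computable k a" "computable k b" "computable k f" "computable k g"
  shows "computable k (\<lambda>xs. if a xs = b xs then f xs else g xs)"
proof -
  have "computable k (\<lambda>xs. if (a xs - b xs) + (b xs - a xs) = 0 then f xs else g xs)"
    by (intro computable_if computable_add computable_diff assms)
  then show ?thesis
    by (rule computable_cong) (auto intro: le_antisym)
qed

lemma computable_triangle:
  assumes "computable k f"
  shows "computable k (\<lambda>xs. triangle (f xs))"
proof -
  have "rec_nat 0 (\<lambda>j y. y + Suc j) a = triangle a" for a
    by (induction a) auto
  moreover have "computable k (\<lambda>xs. rec_nat 0 (\<lambda>j y. y + Suc j) (f xs))"
    by (rule computable_rec_nat[where G = "\<lambda>y j xs. y + Suc j"])
      (intro assms computable_const computable_add computable_Suc computable_nth | simp)+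
  ultimately show ?thesis by simp
qed

lemma computable_prod_encode:
  assumes "computable k f" "computable k g"
  shows "computable k (\<lambda>xs. prod_encode (f xs, g xs))"
  unfolding prod_encode_def prod.case
  by (intro computable_add computable_triangle assms)

text \<open>The antidiagonal of the Cantor pairing on which \<open>k\<close> lies, that is, the
  largest \<open>s\<close> with \<open>triangle s \<le> k\<close>. It can be updated while counting
  up to \<open>k\<close>, which makes decoding primitive recursive.\<close>

definition diagonal :: "nat \<Rightarrow> nat" where
  "diagonal k = fst (prod_decode k) + snd (prod_decode k)"

lemma triangle_diagonal_plus_fst: "triangle (diagonal k) + fst (prod_decode k) = k"
  using prod_decode_inverse[of k]
  by (simp add: prod_encode_def diagonal_def split_beta del: prod_decode_inverse)

lemma diagonal_eqI:
  assumes "triangle s \<le> k" "k < triangle (Suc s)"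
  shows "diagonal k = s"
proof -
  have "prod_encode (k - triangle s, s - (k - triangle s)) = k"
    using assms by (simp add: prod_encode_def)
  then have "prod_decode k = (k - triangle s, s - (k - triangle s))"
    by (metis prod_encode_inverse)
  then show ?thesis using assms by (simp add: diagonal_def)
qed

lemma diagonal_bounds: "triangle (diagonal k) \<le> k" "k < triangle (Suc (diagonal k))"
proof -
  have "fst (prod_decode k) \<le> diagonal k" by (simp add: diagonal_def)
  then show "triangle (diagonal k) \<le> k" "k < triangle (Suc (diagonal k))"
    using triangle_diagonal_plus_fst[of k] by auto
qed

lemma diagonal_Suc:
  "diagonal (Suc k) =
     (if triangle (Suc (diagonal k)) \<le> Suc k then Suc (diagonal k) else diagonal k)"
  using diagonal_bounds[of k] by (auto intro!: diagonal_eqI)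

lemma computable_diagonal:
  assumes "computable k f"
  shows "computable k (\<lambda>xs. diagonal (f xs))"
proof -
  have "rec_nat 0 (\<lambda>j y. if triangle (Suc y) \<le> Suc j then Suc y else y) a = diagonal a" for a
  proof (induction a)
    case 0
    then show ?case using diagonal_eqI[of 0 0] by simp
  qed (simp add: diagonal_Suc)
  moreover have "computable k
      (\<lambda>xs. rec_nat 0 (\<lambda>j y. if triangle (Suc y) \<le> Suc j then Suc y else y) (f xs))"
    by (rule computable_rec_nat[where G = "\<lambda>y j xs. if triangle (Suc y) \<le> Suc j then Suc y else y"])
      (intro assms computable_const computable_if_le computable_triangle computable_Suc computable_nth | simp)+
  ultimately show ?thesis by simp
qed

lemma computable_prod_decode:
  assumes "computable k f"
  shows "computable k (\<lambda>xs. fst (prod_decode (f xs)))"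
    and "computable k (\<lambda>xs. snd (prod_decode (f xs)))"
proof -
  have 1: "fst (prod_decode a) = a - triangle (diagonal a)" for a
    using triangle_diagonal_plus_fst[of a] by simp
  have 2: "snd (prod_decode a) = diagonal a - fst (prod_decode a)" for a
    by (simp add: diagonal_def)
  show *: "computable k (\<lambda>xs. fst (prod_decode (f xs)))"
    unfolding 1 by (intro computable_diff computable_triangle computable_diagonal assms)
  show "computable k (\<lambda>xs. snd (prod_decode (f xs)))"
    unfolding 2 by (intro computable_diff computable_diagonal assms *)
qed

subsection \<open>Lists\<close>

definition code_hd :: "nat \<Rightarrow> nat" where
  "code_hd c = fst (prod_decode (c - 1))"

text \<open>Truncated subtraction keeps 0, the code of the empty list, fixed, in accordance with
  \<open>tl [] = []\<close>.\<close>

definition code_tl :: "nat \<Rightarrow> nat" where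
  "code_tl c = snd (prod_decode (c - 1))"

lemma code_hd_list_encode: "code_hd (list_encode (x # xs)) = x"
  by (simp add: code_hd_def)

lemma code_tl_list_encode: "code_tl (list_encode xs) = list_encode (tl xs)"
proof (cases xs)
  case Nil
  have "prod_decode 0 = (0, 0)"
    by (simp add: prod_decode_def prod_decode_aux.simps)
  then show ?thesis using Nil by (simp add: code_tl_def)
qed (simp add: code_tl_def)

lemma computable_code_hd: "computable k f \<Longrightarrow> computable k (\<lambda>xs. code_hd (f xs))"
  unfolding code_hd_def by (intro computable_prod_decode computable_diff computable_const)

lemma computable_code_tl: "computable k f \<Longrightarrow> computable k (\<lambda>xs. code_tl (f xs))"
  unfolding code_tl_def by (intro computable_prod_decode computable_diff computable_const)

definition code_fold :: "(nat \<Rightarrow> nat \<Rightarrow> nat) \<Rightarrow> nat \<Rightarrow> nat \<Rightarrow> nat" where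
  "code_fold h c a = fold h (list_decode c) a"

lemma length_le_list_encode: "length xs \<le> list_encode xs"
proof (induction xs)
  case (Cons x xs)
  then show ?case using le_prod_encode_2[of "list_encode xs" x] by simp
qed simp

text \<open>A code is at least the length of its list, so it can serve as the number of iterations;
  past the end the remaining code is 0 and the step changes nothing.\<close>

lemma computable_code_fold:
  assumes h: "computable 2 (\<lambda>ys. h (ys ! 0) (ys ! 1))" and c: "computable k c" and a: "computable k a"
  shows "computable k (\<lambda>xs. code_fold h (c xs) (a xs))"
proof -
  define rest where "rest j d = rec_nat d (\<lambda>_ y. code_tl y) j" for j d
  have rest: "rest j (list_encode l) = list_encode (drop j l)" for j l
    by (induction j) (simp_all add: rest_def code_tl_list_encode drop_Suc tl_drop)
  have computable_rest: "computable k (\<lambda>xs. rest (f xs) (g xs))"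
    if "computable k f" "computable k g" for k f g
    unfolding rest_def
    by (rule computable_rec_nat[where G = "\<lambda>y j xs. code_tl y"])
      (intro that computable_code_tl computable_nth | simp)+
  define step where "step d y j = (if rest j d = 0 then y else h (code_hd (rest j d)) y)" for d y j
  have step: "rec_nat b (\<lambda>j y. step (list_encode l) y j) j = fold h (take j l) b" for b l j
  proof (induction j)
    case (Suc j)
    show ?case
    proof (cases "j < length l")
      case True
      then have "drop j l = l ! j # drop (Suc j) l" by (simp add: Cons_nth_drop_Suc)
      then show ?thesis
        using Suc True by (simp add: step_def rest code_hd_list_encode take_Suc_conv_app_nth
            del: list_encode.simps(2)) simp
    qed (use Suc in \<open>simp add: step_def rest\<close>)
  qed simp
  have "rec_nat b (\<lambda>j y. step d y j) d = code_fold h d b" for b d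
    using step[of b "list_decode d" d] length_le_list_encode[of "list_decode d"]
    by (simp add: code_fold_def)
  moreover have "computable k (\<lambda>xs. rec_nat (a xs) (\<lambda>j y. step (c xs) y j) (c xs))"
    by (rule computable_rec_nat[where G = "\<lambda>y j xs. step (c xs) y j"], rule a, unfold step_def)
      (intro computable_if computable_comp2[OF h] computable_rest computable_code_hd
        computable_drop2[OF c] computable_nth c | simp)+
  ultimately show ?thesis by simp
qed

subsection \<open>Words\<close>

abbreviation encode_letter :: "letter \<Rightarrow> nat" where
  "encode_letter \<equiv> (\<lambda>(i, b). 2 * i + of_bool b)"

definition decode_letter :: "nat \<Rightarrow> letter" where
  "decode_letter c = (c div 2, odd c)"

lemma decode_encode_letter [simp]: "decode_letter (encode_letter a) = a"
  by (cases a) (auto simp: decode_letter_def)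

lemma encode_letter_less_iff: "encode_letter a < 2 * n \<longleftrightarrow> fst a < n"
  by (cases a) auto

definition decode_word :: "nat \<Rightarrow> word" where
  "decode_word c = map decode_letter (list_decode c)"

lemma decode_encode_word [simp]: "decode_word (encode_word w) = w"
  by (induction w) (simp_all add: decode_word_def encode_word_def del: list_encode.simps)

text \<open>Exchanges \<open>2 * i\<close> and \<open>2 * i + 1\<close>, the codes of a letter and
  its inverse.\<close>

definition code_inv :: "nat \<Rightarrow> nat" where
  "code_inv c = c + 1 - 2 * (c mod 2)"

lemma code_inv_eq_iff: "encode_letter b = code_inv (encode_letter a) \<longleftrightarrow> b = inv_letter a"
proof -
  have "code_inv (encode_letter a) = encode_letter (inv_letter a)"
    by (cases a) (auto simp: code_inv_def inv_letter_def)
  then show ?thesis by (metis decode_encode_letter)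
qed

lemma computable_code_inv:
  assumes "computable k f"
  shows "computable k (\<lambda>xs. code_inv (f xs))"
proof -
  have "rec_nat 0 (\<lambda>_ y. 1 - y) c = c mod 2" for c :: nat
    by (induction c) (auto simp: mod_Suc)
  moreover have "computable k (\<lambda>xs. rec_nat 0 (\<lambda>_ y. 1 - y) (f xs))"
    by (rule computable_rec_nat[where G = "\<lambda>y j xs. 1 - y"])
      (intro assms computable_const computable_diff computable_nth | simp)+
  ultimately have "computable k (\<lambda>xs. f xs mod 2)" by simp
  then show ?thesis
    unfolding code_inv_def
    by (intro computable_diff computable_add computable_mult_const computable_const assms)
qed

definition code_cons_letter :: "nat \<Rightarrow> nat \<Rightarrow> nat" where
  "code_cons_letter a c =
     (if c = 0 then Suc (prod_encode (a, c))
      else if code_hd c = code_inv a then code_tl c else Suc (prod_encode (a, c)))"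

lemma code_cons_letter:
  "code_cons_letter (encode_letter a) (encode_word w) = encode_word (cons_letter a w)"
proof (cases w)
  case (Cons b v)
  then have "encode_word w = list_encode (encode_letter b # map encode_letter v)"
    by (simp add: encode_word_def)
  then show ?thesis
    using Cons code_inv_eq_iff[of b a]
    by (simp add: code_cons_letter_def code_hd_list_encode code_tl_list_encode encode_word_def
        del: list_encode.simps(2)) simp
qed (simp add: code_cons_letter_def encode_word_def)

lemma computable_code_cons_letter:
  "computable k f \<Longrightarrow> computable k g \<Longrightarrow> computable k (\<lambda>xs. code_cons_letter (f xs) (g xs))"
  unfolding code_cons_letter_def
  by (intro computable_if computable_if_eq computable_Suc computable_prod_encode
      computable_code_hd computable_code_tl computable_code_inv)

text \<open>A word code is scanned from its head, so the accumulated words are stored in reverse.\<close>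
lemma fold_code_cons_letter:
  "fold code_cons_letter (map encode_letter w) (encode_word (reduce (rev x)))
     = encode_word (reduce (rev (x @ w)))"
proof (induction w arbitrary: x)
  case (Cons a w)
  have "code_cons_letter (encode_letter a) (encode_word (reduce (rev x)))
      = encode_word (reduce (rev (x @ [a])))"
    by (simp add: code_cons_letter)
  then show ?case using Cons[of "x @ [a]"] by simp
qed simp

lemma code_fold_cons_letter:
  "code_fold code_cons_letter (encode_word w) (encode_word (reduce (rev x)))
     = encode_word (reduce (rev (x @ w)))"
  using fold_code_cons_letter[of w x] by (simp add: code_fold_def encode_word_def)

text \<open>Skipping the letters outside the alphabet lets a bounded search run over all codes.\<close>
definition code_subst :: "nat \<Rightarrow> (letter \<Rightarrow> word) \<Rightarrow> nat \<Rightarrow> nat \<Rightarrow> nat" where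
  "code_subst n f a c =
     (if a < 2 * n then fold code_cons_letter (map encode_letter (f (decode_letter a))) c else c)"

lemma code_fold_subst:
  "code_fold (code_subst n f) c (encode_word (reduce (rev x)))
     = encode_word (reduce (rev (x @ concat (map f (filter (\<lambda>a. fst a < n) (decode_word c))))))"
proof -
  have "fold (code_subst n f) l (encode_word (reduce (rev x))) = encode_word (reduce (rev
      (x @ concat (map f (filter (\<lambda>a. fst a < n) (map decode_letter l))))))" for l
  proof (induction l arbitrary: x)
    case (Cons a l)
    have "a < 2 * n \<longleftrightarrow> fst (decode_letter a) < n"
      by (auto simp: decode_letter_def)
    then show ?case
      using Cons[of x] Cons[of "x @ f (decode_letter a)"]
      by (simp add: code_subst_def fold_code_cons_letter)
  qed simp
  then show ?thesis by (simp add: code_fold_def decode_word_def)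
qed

text \<open>Although \<open>f\<close> is arbitrary, only its values at the \<open>2 * n\<close>
  letter codes matter. The induction on \<open>N\<close> builds this finite table into the program,
  one constant word per letter.\<close>

lemma computable_code_subst: "computable 2 (\<lambda>ys. code_subst n f (ys ! 0) (ys ! 1))"
proof -
  have fold: "computable 2 (\<lambda>ys. fold code_cons_letter l (h ys))" if "computable 2 h" for l h
    using that by (induction l arbitrary: h) (simp_all add: computable_code_cons_letter computable_const)
  have "computable 2 (\<lambda>ys. if ys ! 0 < N
      then fold code_cons_letter (map encode_letter (f (decode_letter (ys ! 0)))) (ys ! 1) else ys ! 1)" for N
  proof (induction N)
    case 0
    then show ?case by (simp add: computable_nth)
  next
    case (Suc N)
    have "computable 2 (\<lambda>ys. if ys ! 0 = N
        then fold code_cons_letter (map encode_letter (f (decode_letter N))) (ys ! 1)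
        else if ys ! 0 < N
        then fold code_cons_letter (map encode_letter (f (decode_letter (ys ! 0)))) (ys ! 1) else ys ! 1)"
      by (intro computable_if_eq fold Suc computable_nth computable_const) simp_all
    then show ?case by (rule computable_cong) (auto simp: less_Suc_eq)
  qed
  then show ?thesis unfolding code_subst_def .
qed

text \<open>The search is a primitive recursion over the whole range, so it halts with answer 0 when
  there is no witness.\<close>

lemma computable_bounded_ex:
  assumes "computable 3 (\<lambda>ys. of_bool (T (ys ! 0) (ys ! 1) (ys ! 2)))" "computable 2 b"
  shows "computable 2 (\<lambda>xs. of_bool (\<exists>j<b xs. T j (xs ! 0) (xs ! 1)))"
proof -
  have "rec_nat 0 (\<lambda>j y. if of_bool (T j u v) = (0::nat) then y else 1) N = (of_bool (\<exists>j<N. T j u v) :: nat)"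
    for N u v
    by (induction N) (auto simp: less_Suc_eq)
  moreover have "computable 2 (\<lambda>xs. rec_nat 0
      (\<lambda>j y. if of_bool (T j (xs ! 0) (xs ! 1)) = (0::nat) then y else 1) (b xs))"
    by (rule computable_rec_nat[where
          G = "\<lambda>y j xs. if of_bool (T j (xs ! 0) (xs ! 1)) = (0::nat) then y else 1"])
      (intro computable_if computable_const computable_comp3[OF assms(1)] assms(2)
        computable_nth computable_drop2[of _ "\<lambda>xs. xs ! 0"] computable_drop2[of _ "\<lambda>xs. xs ! 1"] | simp)+
  ultimately show ?thesis by (simp only:)
qed

text \<open>Follows the recursion of \<open>list_encode\<close>, with \<open>2 * n\<close> above all
  letter codes and \<open>y\<close> above the code of the tail. One \<open>Suc\<close> comes from
  the encoding, the other keeps the bound strict.\<close>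

definition code_bound :: "nat \<Rightarrow> nat \<Rightarrow> nat" where
  "code_bound n N = rec_nat 1 (\<lambda>_ y. Suc (Suc (prod_encode (2 * n, y)))) N"

lemma encode_word_less_code_bound:
  assumes "w \<in> words n" "length w \<le> N"
  shows "encode_word w < code_bound n N"
  using assms
proof (induction N arbitrary: w)
  case 0
  then show ?case by (simp add: encode_word_def code_bound_def)
next
  case (Suc N)
  show ?case
  proof (cases w)
    case Nil
    then show ?thesis by (simp add: encode_word_def code_bound_def)
  next
    case (Cons a v)
    then have "encode_word v < code_bound n N" "fst a < n"
      using Suc by (auto simp: words_def)
    moreover have mono: "prod_encode (i, j) \<le> prod_encode (i', j')" if "i \<le> i'" "j \<le> j'" for i j i' j'
      using that by (auto simp: prod_encode_def triangle_def intro!: add_mono div_le_mono mult_mono)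
    ultimately have "prod_encode (encode_letter a, encode_word v)
        \<le> prod_encode (2 * n, code_bound n N)"
      using encode_letter_less_iff[of a n] by (intro mono) auto
    then show ?thesis
      using Cons by (simp add: encode_word_def code_bound_def)
  qed
qed

lemma computable_code_bound:
  assumes "computable k f"
  shows "computable k (\<lambda>xs. code_bound n (f xs))"
  unfolding code_bound_def
  by (rule computable_rec_nat[where G = "\<lambda>y j xs. Suc (Suc (prod_encode (2 * n, y)))"])
    (intro assms computable_Suc computable_prod_encode computable_const computable_nth | simp)+

lemma length_le_encode_word: "length w \<le> encode_word w"
  using length_le_list_encode[of "map encode_letter w"] by (simp add: encode_word_def)

lemma decidable_on_wordsI:
  assumes "computable 2 f"
    and "\<And>U V. U \<in> words n \<Longrightarrow> V \<in> words n \<Longrightarrow> f [encode_word U, encode_word V] = of_bool (R U V)"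
  shows "decidable_on_words n R"
proof -
  obtain p where p: "\<And>xs. length xs = 2 \<Longrightarrow> eval p xs (f xs)"
    using assms(1) by (auto simp: computable_def)
  have "eval p [encode_word U, encode_word V] (of_bool (R U V))"
    if "U \<in> words n" "V \<in> words n" for U V
    using p[of "[encode_word U, encode_word V]"] assms(2)[OF that] by simp
  then show ?thesis unfolding decidable_on_words_def by blast
qed

section \<open>Solving the twisted conjugacy problem\<close>

text \<open>Being mutually inverse is a symmetric relation between letters, so reduction commutes
  with reversal. This undoes the reversal caused by scanning codes from the head.\<close>

lemma reduce_rev: "reduce (rev w) = rev (reduce w)"
proof -
  have reduced_rev: "reduced (rev x)" if "reduced x" for x
    using that unfolding reduced_def by (auto elim!: successively_mono)
  have snoc: "reduce (rev x @ [a]) = rev (cons_letter a x)" if x: "reduced x" for a x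
  proof (cases "\<exists>y. x = inv_letter a # y")
    case True
    then obtain y where y: "x = inv_letter a # y" ..
    then show ?thesis
      using reduce_cancel[of "rev y" "inv_letter a" "[]"] reduce_reduced[OF reduced_rev, of y] x
      by (simp add: reduced_ConsD)
  next
    case False
    then have "cons_letter a x = a # x" by (cases x) auto
    then show ?thesis
      using reduce_reduced[OF reduced_rev, of "a # x"] reduced_cons_letter[OF x, of a] by simp
  qed
  show ?thesis
  proof (induction w)
    case (Cons a w)
    have "reduce (rev (a # w)) = reduce (reduce (rev w) @ [a])"
      by (simp add: reduce_append_left)
    then show ?case using Cons snoc[OF reduced_reduce] by simp
  qed simp
qed

lemma reduce_rev_eq_iff: "reduce (rev x) = reduce (rev y) \<longleftrightarrow> reduce x = reduce y"
  by (simp add: reduce_rev)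

section \<open>The decision procedure\<close>

context virtually_inner_aut
begin

lemma reduce_concat_\<phi>: "w \<in> words n \<Longrightarrow> reduce (concat (map (\<lambda>a. \<phi> [a]) w)) = \<phi> (reduce w)"
proof (induction w)
  case Nil
  then show ?case using \<phi>.hom_one by (simp add: one_eq)
next
  case (Cons a w)
  then have "[a] \<in> carrier F" "w \<in> words n"
    by (auto simp: carrier_iff words_def)
  moreover from this have "reduce w \<in> carrier F"
    by (simp add: F_def reduce_in_carrier)
  moreover have "reduce (a # w) = [a] \<otimes> reduce w"
    using reduce_append_right[of "[a]" w] by (simp add: mult_eq)
  moreover have "reduce (concat (map (\<lambda>a. \<phi> [a]) (a # w)))
      = \<phi> [a] \<otimes> reduce (concat (map (\<lambda>a. \<phi> [a]) w))"
    by (simp add: mult_eq reduce_append_right)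
  ultimately show ?case using Cons.IH by simp
qed

lemma twisted_conjugacy_decidable:
  "decidable_on_words n (\<lambda>U V. \<exists>X\<in>carrier F. \<phi> X \<otimes> reduce U = reduce V \<otimes> X)"
proof -
  obtain A where A: "\<And>U V X. U \<in> carrier F \<Longrightarrow> V \<in> carrier F \<Longrightarrow> X \<in> carrier F \<Longrightarrow> \<phi> X \<otimes> U = V \<otimes> X \<Longrightarrow>
      \<exists>X\<in>carrier F. \<phi> X \<otimes> U = V \<otimes> X \<and> length X \<le> A * Suc (length U + length V)"
    using twisted_conjugator_linear_bound by blast
  \<comment> \<open>The inner fold supplies the left factor, since later letters extend the
    accumulated word on the right; the initial 0 is the code of the empty word.\<close>
  define lhs where "lhs j u = code_fold code_cons_letter u (code_fold (code_subst n (\<lambda>a. \<phi> [a])) j 0)" for j u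
  define rhs where "rhs j v = code_fold (code_subst n (\<lambda>a. [a])) j (code_fold code_cons_letter v 0)" for j v
  define T where "T j u v \<longleftrightarrow> lhs j u = rhs j v" for j u v
  \<comment> \<open>The codes \<open>u\<close> and \<open>v\<close> replace the lengths of the
    words, which they dominate, so the search range can only grow.\<close>
  define b where "b u v = code_bound n (A * Suc (u + v))" for u v
  define word where "word j = filter (\<lambda>a. fst a < n) (decode_word j)" for j
  have word: "word j \<in> words n" for j
    by (auto simp: word_def words_def)
  have test: "T j (encode_word U) (encode_word V)
      \<longleftrightarrow> \<phi> (reduce (word j)) \<otimes> reduce U = reduce V \<otimes> reduce (word j)"
    for j U V
  proof -
    have zero: "0 = encode_word (reduce (rev []))" by (simp add: encode_word_def)
    have "lhs j (encode_word U)
        = encode_word (reduce (rev (concat (map (\<lambda>a. \<phi> [a]) (word j)) @ U)))"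
      unfolding lhs_def zero code_fold_subst code_fold_cons_letter by (simp add: word_def)
    moreover have "rhs j (encode_word V) = encode_word (reduce (rev (V @ word j)))"
      unfolding rhs_def zero code_fold_subst code_fold_cons_letter by (simp add: word_def)
    ultimately have "T j (encode_word U) (encode_word V)
        \<longleftrightarrow> reduce (concat (map (\<lambda>a. \<phi> [a]) (word j)) @ U) = reduce (V @ word j)"
      by (simp only: T_def inj_encode_word[THEN inj_eq] reduce_rev_eq_iff)
    then show ?thesis
      by (simp only: reduce_append[where n = n, folded F_def] reduce_concat_\<phi>[OF word])
  qed
  have "computable 2 (\<lambda>xs. of_bool (\<exists>j<b (xs ! 0) (xs ! 1). T j (xs ! 0) (xs ! 1)))"
  proof (rule computable_bounded_ex)
    have "computable 3 (\<lambda>ys. if lhs (ys ! 0) (ys ! 1) = rhs (ys ! 0) (ys ! 2) then 1 else 0)"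
      unfolding lhs_def rhs_def
      by (intro computable_if_eq computable_code_fold computable_code_subst
          computable_code_cons_letter computable_nth computable_const) simp_all
    then show "computable 3 (\<lambda>ys. of_bool (T (ys ! 0) (ys ! 1) (ys ! 2)))"
      by (rule computable_cong) (simp add: T_def)
    show "computable 2 (\<lambda>xs. b (xs ! 0) (xs ! 1))"
      unfolding b_def
      by (intro computable_code_bound computable_mult_const computable_Suc computable_add
          computable_nth) simp_all
  qed
  then show ?thesis
  proof (rule decidable_on_wordsI)
    fix U V
    assume U: "U \<in> words n" and V: "V \<in> words n"
    have carr: "reduce U \<in> carrier F" "reduce V \<in> carrier F"
      using U V by (simp_all add: F_def reduce_in_carrier)
    have "(\<exists>j<b (encode_word U) (encode_word V). T j (encode_word U) (encode_word V))
        \<longleftrightarrow> (\<exists>X\<in>carrier F. \<phi> X \<otimes> reduce U = reduce V \<otimes> X)"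
    proof
      assume "\<exists>j<b (encode_word U) (encode_word V). T j (encode_word U) (encode_word V)"
      then obtain j where "\<phi> (reduce (word j)) \<otimes> reduce U = reduce V \<otimes> reduce (word j)"
        unfolding test by blast
      moreover have "reduce (word j) \<in> carrier F"
        using word by (simp add: F_def reduce_in_carrier)
      ultimately show "\<exists>X\<in>carrier F. \<phi> X \<otimes> reduce U = reduce V \<otimes> X" by blast
    next
      assume "\<exists>X\<in>carrier F. \<phi> X \<otimes> reduce U = reduce V \<otimes> X"
      then obtain X where X: "X \<in> carrier F" "\<phi> X \<otimes> reduce U = reduce V \<otimes> X"
        "length X \<le> A * Suc (length (reduce U) + length (reduce V))"
        using A carr by blast
      have "length (reduce W) \<le> encode_word W" for W
        using length_reduce_le[of W] length_le_encode_word[of W] by simp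
      then have le: "A * Suc (length (reduce U) + length (reduce V))
          \<le> A * Suc (encode_word U + encode_word V)"
        by (intro mult_le_mono2) (simp add: add_mono)
      have less: "encode_word X < b (encode_word U) (encode_word V)"
        unfolding b_def using X(1) le_trans[OF X(3) le]
        by (intro encode_word_less_code_bound) (simp_all add: carrier_iff)
      have "word (encode_word X) = X"
        using X(1) by (auto simp: word_def carrier_iff words_def filter_id_conv)
      then have "T (encode_word X) (encode_word U) (encode_word V)"
        using X(1,2) by (simp add: test carrier_iff reduce_reduced)
      then show "\<exists>j<b (encode_word U) (encode_word V). T j (encode_word U) (encode_word V)"
        using less by blast
    qed
    then show "of_bool (\<exists>j<b ([encode_word U, encode_word V] ! 0) ([encode_word U, encode_word V] ! 1).
          T j ([encode_word U, encode_word V] ! 0) ([encode_word U, encode_word V] ! 1))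
        = (of_bool (\<exists>X\<in>carrier F. \<phi> X \<otimes> reduce U = reduce V \<otimes> X) :: nat)"
      by simp
  qed
qed

end

section \<open>From powers in the automorphism group to iterated maps\<close>

context finite_rank_free_group
begin

lemma AutoGroup_mult:
  assumes "f \<in> carrier (AutoGroup F)" "h \<in> carrier (AutoGroup F)" "x \<in> carrier F"
  shows "(f \<otimes>\<^bsub>AutoGroup F\<^esub> h) x = f (h x)"
  using assms by (simp add: AutoGroup_def BijGroup_def auto_def compose_def)

lemma AutoGroup_one: "x \<in> carrier F \<Longrightarrow> \<one>\<^bsub>AutoGroup F\<^esub> x = x"
  by (simp add: AutoGroup_def BijGroup_def)

lemma AutoGroup_nat_pow:
  assumes "\<phi> \<in> carrier (AutoGroup F)" "x \<in> carrier F"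
  shows "(\<phi> [^]\<^bsub>AutoGroup F\<^esub> (k::nat)) x = (\<phi> ^^ k) x \<and> (\<phi> ^^ k) x \<in> carrier F"
  using assms(2)
proof (induction k arbitrary: x)
  case 0
  then show ?case by (simp add: AutoGroup_one)
next
  case (Suc k)
  interpret A: group "AutoGroup F" by (rule AutoGroup)
  have "\<phi> \<in> Bij (carrier F)"
    using assms(1) by (simp add: AutoGroup_def auto_def)
  then have "\<phi> x \<in> carrier F"
    using Suc.prems Bij_imp_funcset by blast
  moreover have "(\<phi> [^]\<^bsub>AutoGroup F\<^esub> Suc k) x = (\<phi> [^]\<^bsub>AutoGroup F\<^esub> k) (\<phi> x)"
    unfolding A.nat_pow_Suc
    by (rule AutoGroup_mult[OF A.nat_pow_closed[OF assms(1)] assms(1) Suc.prems])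
  ultimately show ?case
    using Suc.IH[of "\<phi> x"] by (simp add: funpow_swap1)
qed

text \<open>For a negative exponent, the opposite power inverts conjugation by \<open>g\<close>, so
  it is conjugation by \<open>inv g\<close>.\<close>

lemma virtually_inner_natE:
  assumes \<phi>: "\<phi> \<in> carrier (AutoGroup F)" and "virtually_inner F \<phi>"
  obtains m :: nat and g where "m > 0" "g \<in> carrier F"
    "\<And>x. x \<in> carrier F \<Longrightarrow> (\<phi> ^^ m) x = g \<otimes> x \<otimes> inv g"
proof -
  interpret A: group "AutoGroup F" by (rule AutoGroup)
  obtain k :: int and g where k: "k \<noteq> 0" and g: "g \<in> carrier F"
    and kg: "\<phi> [^]\<^bsub>AutoGroup F\<^esub> k = (\<lambda>x\<in>carrier F. g \<otimes> x \<otimes> inv g)"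
    using assms(2) unfolding virtually_inner_def Inn_def
    by (elim exE conjE imageE) (rule that)
  show thesis
  proof (cases "k > 0")
    case True
    then have "\<phi> [^]\<^bsub>AutoGroup F\<^esub> k = \<phi> [^]\<^bsub>AutoGroup F\<^esub> nat k"
      by (subst int_pow_def2, intro if_not_P) linarith
    then have "(\<phi> ^^ nat k) x = g \<otimes> x \<otimes> inv g" if "x \<in> carrier F" for x
      using AutoGroup_nat_pow[OF \<phi> that, of "nat k"] fun_cong[OF kg, of x] that
      by (simp only: restrict_apply if_True)
    then show thesis using that[of "nat k" g] True g by simp
  next
    case False
    let ?\<psi> = "\<phi> [^]\<^bsub>AutoGroup F\<^esub> nat (- k)"
    have "\<phi> [^]\<^bsub>AutoGroup F\<^esub> k = inv\<^bsub>AutoGroup F\<^esub> ?\<psi>"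
      using False k by (subst int_pow_def2, intro if_P) linarith
    then have one: "?\<psi> \<otimes>\<^bsub>AutoGroup F\<^esub> (\<phi> [^]\<^bsub>AutoGroup F\<^esub> k) = \<one>\<^bsub>AutoGroup F\<^esub>"
      using A.r_inv[OF A.nat_pow_closed[OF \<phi>]] by (simp only:)
    have inverse: "?\<psi> ((\<phi> [^]\<^bsub>AutoGroup F\<^esub> k) x) = x" if "x \<in> carrier F" for x
      using fun_cong[OF one, of x] AutoGroup_mult[OF A.nat_pow_closed[OF \<phi>] A.int_pow_closed[OF \<phi>] that]
      by (simp only: AutoGroup_one[OF that])
    have "(\<phi> ^^ nat (- k)) x = inv g \<otimes> x \<otimes> inv (inv g)" if x: "x \<in> carrier F" for x
    proof -
      let ?y = "inv g \<otimes> x \<otimes> g"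
      have y: "?y \<in> carrier F" using x g by simp
      have "(\<phi> [^]\<^bsub>AutoGroup F\<^esub> k) ?y = x"
        using y x g by (simp add: kg m_assoc)
      then show ?thesis
        using inverse[OF y] AutoGroup_nat_pow[OF \<phi> x, of "nat (- k)"] g by simp
    qed
    then show thesis using that[of "nat (- k)" "inv g"] False k g by simp
  qed
qed

text \<open>The element \<open>g\<^sup>-\<^sup>1 \<phi>(g)\<close> is central; if it is nontrivial, then \<open>F\<close> is abelian, and \<open>g = 1\<close> will do.\<close>
lemma virtually_inner_fixed_natE:
  assumes \<phi>: "\<phi> \<in> carrier (AutoGroup F)" and vi: "virtually_inner F \<phi>"
  obtains m g where "virtually_inner_aut n F \<phi> m g"
proof -
  have hom: "\<phi> \<in> hom F F" and bij: "bij_betw \<phi> (carrier F) (carrier F)"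
    using \<phi> by (auto simp: AutoGroup_def auto_def Bij_def)
  interpret \<phi>: group_hom F F \<phi> by unfold_locales (rule hom)
  obtain m :: nat and g where m: "m > 0" and g: "g \<in> carrier F"
    and mg: "\<And>x. x \<in> carrier F \<Longrightarrow> (\<phi> ^^ m) x = g \<otimes> x \<otimes> inv g"
    using virtually_inner_natE[OF \<phi> vi] by blast
  define z where "z = inv g \<otimes> \<phi> g"
  have z: "z \<in> carrier F" using g by (simp add: z_def)
  have central: "z \<otimes> y = y \<otimes> z" if y: "y \<in> carrier F" for y
  proof -
    obtain x where x: "x \<in> carrier F" "y = \<phi> x"
      using bij y by (auto simp: bij_betw_def)
    \<comment> \<open>Since \<phi> commutes with its own power, conjugation by \<open>g\<close> and
      by \<open>\<phi> g\<close> agree on the image of \<phi>, which is all of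
      \<open>F\<close>.\<close>
    have "g \<otimes> \<phi> x \<otimes> inv g = \<phi> ((\<phi> ^^ m) x)"
      using mg[of "\<phi> x"] x(1) by (simp add: funpow_swap1)
    also have "\<dots> = \<phi> g \<otimes> \<phi> x \<otimes> inv (\<phi> g)"
      using mg[OF x(1)] g x(1) by simp
    finally have "inv g \<otimes> (\<phi> g \<otimes> \<phi> x \<otimes> inv (\<phi> g)) \<otimes> \<phi> g = inv g \<otimes> (g \<otimes> \<phi> x \<otimes> inv g) \<otimes> \<phi> g"
      by simp
    then show ?thesis using g x by (simp add: z_def m_assoc)
  qed
  show thesis
  proof (cases "z = \<one>")
    case True
    then have "g \<otimes> z = g" using g by simp
    then have "\<phi> g = g" using g by (simp add: z_def)
    then have "virtually_inner_aut n F \<phi> m g"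
      using hom bij m g mg by unfold_locales
    then show thesis by (rule that)
  next
    case False
    have "(\<phi> ^^ m) x = \<one> \<otimes> x \<otimes> inv \<one>" if x: "x \<in> carrier F" for x
    proof -
      have "g \<otimes> x = x \<otimes> g"
        using commute_trans[OF z False g central[OF g] x central[OF x]] .
      then show ?thesis using mg[OF x] g x by (simp add: m_assoc)
    qed
    then have "virtually_inner_aut n F \<phi> m \<one>"
      using hom bij m by unfold_locales auto
    then show thesis by (rule that)
  qed
qed

end

theorem theorem1:
  fixes n :: nat and \<phi> :: "word \<Rightarrow> word"
  assumes "\<phi> \<in> carrier (AutoGroup (free_group n))"
    and "virtually_inner (free_group n) \<phi>"
  shows "twisted_conjugacy_problem_solvable n \<phi>"
proof -
  interpret finite_rank_free_group n "free_group n"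
    by unfold_locales (rule refl)
  obtain m g where "virtually_inner_aut n (free_group n) \<phi> m g"
    using virtually_inner_fixed_natE[OF assms] .
  then show ?thesis
    unfolding twisted_conjugacy_problem_solvable_def
    by (rule virtually_inner_aut.twisted_conjugacy_decidable)
qed

end
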